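(* Let $\mathbb{k}$ be a field, let $P$ be a finite graded poset of rank $d\ge 2$ with a minimum element $\hat{0}$, and let $Q$ be the poset obtained from $P$ by removing all maximal elements; set $\bar{P}=P\setminus\{\hat{0}\}$ and $\bar{Q}=Q\setminus\{\hat{0}\}$. (i) If $P$ is Cohen-Macaulay over $\mathbb{k}$ and the open interval $(\hat{0},y)$ in $P$ is doubly Cohen-Macaulay over $\mathbb{k}$ for every maximal element $y$ of $P$, then $\bar{Q}$ is doubly Cohen-Macaulay over $\mathbb{k}$. (ii) If $\bar{P}$ is Buchsbaum over $\mathbb{k}$ and the open interval $(\hat{0},y)$ in $P$ is doubly Cohen-Macaulay over $\mathbb{k}$ for every maximal element $y$ of $P$, then $\bar{Q}$ is Buchsbaum* over $\mathbb{k}$.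
   Context: A finite poset is graded of rank $d$ if its order complex (the simplicial complex of its chains) is pure of dimension $d$. For a simplicial complex $\Delta$ and a face $\sigma$: $\mathrm{lk}_\Delta(\sigma)=\{\tau\setminus\sigma:\sigma\subseteq\tau\in\Delta\}$ and $\mathrm{cost}_\Delta(\sigma)=\{\tau\in\Delta:\sigma\not\subseteq\tau\}$. $\Delta$ is Cohen-Macaulay over $\mathbb{k}$ if $\widetilde{H}_i(\mathrm{lk}_\Delta(\sigma);\mathbb{k})=0$ for all faces $\sigma$ (including $\varnothing$) and all $i<\dim\mathrm{lk}_\Delta(\sigma)$. $\Delta$ is Buchsbaum over $\mathbb{k}$ if it is pure and the same vanishing holds for every nonempty face $\sigma$. A $(d'-1)$-dimensional Buchsbaum complex $\Delta$ over $\mathbb{k}$ is Buchsbaum* over $\mathbb{k}$ if for every nonempty face $\sigma$ the map $\widetilde{H}_{d'-1}(\Delta;\mathbb{k})\to H_{d'-1}(\Delta,\mathrm{cost}_\Delta(\sigma);\mathbb{k})$ induced by inclusion is surjective. A Cohen-Macaulay complex $\Delta$ over $\mathbb{k}$ is doubly Cohen-Macaulay over $\mathbb{k}$ if for every vertex $v$, the complex $\Delta\setminus v=\{\tau\in\Delta:v\notin\tau\}$ is Cohen-Macaulay over $\mathbb{k}$ of the same dimension as $\Delta$. A finite poset has one of these properties if its order complex does. *)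

theory Defs
  imports "HOL-Algebra.Elementary_Groups"
begin

section \<open>Finite simplicial complexes\<close>

text \<open>A complex is the set of its faces.  Every complex considered here contains the empty face;
  the void complex only occurs as the second component of a pair, where it yields reduced
  homology.\<close>

definition simplicial_complex :: "'a set set \<Rightarrow> bool" where
  "simplicial_complex \<Delta> \<longleftrightarrow>
     finite \<Delta> \<and> {} \<in> \<Delta> \<and> (\<forall>s\<in>\<Delta>. finite s) \<and> (\<forall>s\<in>\<Delta>. \<forall>t. t \<subseteq> s \<longrightarrow> t \<in> \<Delta>)"

text \<open>The dimension is an integer, because the complex with only the empty face has dimension -1.\<close>

definition complex_dim :: "'a set set \<Rightarrow> int" where
  "complex_dim \<Delta> = int (Max (card ` \<Delta>)) - 1"

definition facets :: "'a set set \<Rightarrow> 'a set set" where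
  "facets \<Delta> = {s \<in> \<Delta>. \<forall>t\<in>\<Delta>. s \<subseteq> t \<longrightarrow> t = s}"

definition pure_complex :: "'a set set \<Rightarrow> bool" where
  "pure_complex \<Delta> \<longleftrightarrow> (\<forall>s\<in>facets \<Delta>. int (card s) - 1 = complex_dim \<Delta>)"

definition link :: "'a set set \<Rightarrow> 'a set \<Rightarrow> 'a set set" where
  "link \<Delta> s = {t - s |t. s \<subseteq> t \<and> t \<in> \<Delta>}"

definition cost :: "'a set set \<Rightarrow> 'a set \<Rightarrow> 'a set set" where
  "cost \<Delta> s = {t \<in> \<Delta>. \<not> s \<subseteq> t}"

definition deletion :: "'a set set \<Rightarrow> 'a \<Rightarrow> 'a set set" where
  "deletion \<Delta> v = {t \<in> \<Delta>. v \<notin> t}"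


section \<open>Simplicial homology with field coefficients\<close>

text \<open>Simplices are oriented by one linear order on the whole vertex type, chosen once and for
  all, so that the orientations of all complexes on that type are compatible.  For order
  complexes it is unrelated to the order of the poset.\<close>

definition vertex_order :: "'a rel" where
  "vertex_order = (SOME r. linear_order r)"

lemma linear_order_vertex_order: "linear_order (vertex_order :: 'a rel)"
proof -
  have "\<exists>r :: 'a rel. linear_order r"
    using well_order_on[of "UNIV :: 'a set"] by (auto simp: well_order_on_def)
  then show ?thesis
    unfolding vertex_order_def by (rule someI_ex)
qed

text \<open>A chain is its coefficient function on faces.  Degree \<open>-1\<close> is the copy of the field
  spanned by the empty face, i.e. the chain complex is the augmented one.\<close>

definition chain_group :: "'k::field itself \<Rightarrow> int \<Rightarrow> 'a set set \<Rightarrow> ('a set \<Rightarrow> 'k) monoid" where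
  "chain_group k i \<Delta> =
     \<lparr>carrier = {c. \<forall>s. c s \<noteq> 0 \<longrightarrow> s \<in> \<Delta> \<and> int (card s) = i + 1},
      monoid.mult = (\<lambda>a b s. a s + b s), one = (\<lambda>s. 0)\<rparr>"

text \<open>The coefficient of a face \<open>t\<close> in the usual boundary: for \<open>v\<^sub>0 < \<dots> < v\<^sub>p\<close> the simplex
  \<open>{v\<^sub>0, \<dots>, v\<^sub>p}\<close> contributes its face omitting \<open>v\<^sub>j\<close> with the sign \<open>(-1)\<^sup>j\<close>, where \<open>j\<close> is the
  number of remaining vertices below \<open>v\<^sub>j\<close>.\<close>

definition boundary :: "('a set \<Rightarrow> 'k::field) \<Rightarrow> 'a set \<Rightarrow> 'k" where
  "boundary c t =
     (\<Sum>v | v \<notin> t \<and> c (insert v t) \<noteq> 0.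
        (- 1) ^ card {u \<in> t. (u, v) \<in> vertex_order} * c (insert v t))"

definition rel_cycles ::
    "'k::field itself \<Rightarrow> int \<Rightarrow> 'a set set \<Rightarrow> 'a set set \<Rightarrow> ('a set \<Rightarrow> 'k) set" where
  "rel_cycles k i \<Delta> \<Gamma> =
     {c \<in> carrier (chain_group k i \<Delta>). boundary c \<in> carrier (chain_group k (i - 1) \<Gamma>)}"

definition rel_boundaries ::
    "'k::field itself \<Rightarrow> int \<Rightarrow> 'a set set \<Rightarrow> 'a set set \<Rightarrow> ('a set \<Rightarrow> 'k) set" where
  "rel_boundaries k i \<Delta> \<Gamma> =
     boundary ` carrier (chain_group k (i + 1) \<Delta>) <#>\<^bsub>chain_group k i \<Delta>\<^esub> carrier (chain_group k i \<Gamma>)"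

text \<open>The homology of the pair as an abelian group; its scalar multiplication plays no role
  in the vanishing of a group or the surjectivity of a map.  As the chain complex is augmented,
  this is the usual relative homology as soon as both complexes contain the empty face.\<close>

definition rel_homology ::
    "'k::field itself \<Rightarrow> int \<Rightarrow> 'a set set \<Rightarrow> 'a set set \<Rightarrow> ('a set \<Rightarrow> 'k) set monoid" where
  "rel_homology k i \<Delta> \<Gamma> =
     (chain_group k i \<Delta>)\<lparr>carrier := rel_cycles k i \<Delta> \<Gamma>\<rparr> Mod rel_boundaries k i \<Delta> \<Gamma>"

definition reduced_homology ::
    "'k::field itself \<Rightarrow> int \<Rightarrow> 'a set set \<Rightarrow> ('a set \<Rightarrow> 'k) set monoid" where
  "reduced_homology k i \<Delta> = rel_homology k i \<Delta> {}"

text \<open>The map from the reduced homology of \<open>\<Delta>\<close> to the homology of \<open>(\<Delta>, \<Gamma>)\<close> induced by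
  inclusion: the class of a cycle \<open>c\<close>, a coset of the boundaries, is enlarged to the coset of
  \<open>c\<close> modulo the relative boundaries.\<close>

definition homology_map ::
    "'k::field itself \<Rightarrow> int \<Rightarrow> 'a set set \<Rightarrow> 'a set set \<Rightarrow> ('a set \<Rightarrow> 'k) set \<Rightarrow> ('a set \<Rightarrow> 'k) set" where
  "homology_map k i \<Delta> \<Gamma> X = rel_boundaries k i \<Delta> \<Gamma> <#>\<^bsub>chain_group k i \<Delta>\<^esub> X"


section \<open>Homological properties of complexes\<close>

definition cohen_macaulay :: "'k::field itself \<Rightarrow> 'a set set \<Rightarrow> bool" where
  "cohen_macaulay k \<Delta> \<longleftrightarrow>
     simplicial_complex \<Delta> \<and>
     (\<forall>s\<in>\<Delta>. \<forall>i < complex_dim (link \<Delta> s). trivial_group (reduced_homology k i (link \<Delta> s)))"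

definition buchsbaum :: "'k::field itself \<Rightarrow> 'a set set \<Rightarrow> bool" where
  "buchsbaum k \<Delta> \<longleftrightarrow>
     simplicial_complex \<Delta> \<and> pure_complex \<Delta> \<and>
     (\<forall>s\<in>\<Delta>. s \<noteq> {} \<longrightarrow>
        (\<forall>i < complex_dim (link \<Delta> s). trivial_group (reduced_homology k i (link \<Delta> s))))"

definition buchsbaum_star :: "'k::field itself \<Rightarrow> 'a set set \<Rightarrow> bool" where
  "buchsbaum_star k \<Delta> \<longleftrightarrow>
     buchsbaum k \<Delta> \<and>
     (\<forall>s\<in>\<Delta>. s \<noteq> {} \<longrightarrow>
        homology_map k (complex_dim \<Delta>) \<Delta> (cost \<Delta> s) ` carrier (reduced_homology k (complex_dim \<Delta>) \<Delta>)
          = carrier (rel_homology k (complex_dim \<Delta>) \<Delta> (cost \<Delta> s)))"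

definition doubly_cohen_macaulay :: "'k::field itself \<Rightarrow> 'a set set \<Rightarrow> bool" where
  "doubly_cohen_macaulay k \<Delta> \<longleftrightarrow>
     cohen_macaulay k \<Delta> \<and>
     (\<forall>v. {v} \<in> \<Delta> \<longrightarrow>
        cohen_macaulay k (deletion \<Delta> v) \<and> complex_dim (deletion \<Delta> v) = complex_dim \<Delta>)"


section \<open>Finite posets\<close>

text \<open>A finite poset is a finite subset of an ordered type, with the induced order.\<close>

definition order_complex :: "'a::order set \<Rightarrow> 'a set set" where
  "order_complex P = {C. C \<subseteq> P \<and> Complete_Partial_Order.chain (\<le>) C}"

lemma simplicial_complex_order_complex:
  assumes "finite P"
  shows "simplicial_complex (order_complex P)"
  using assms finite_subset
  by (fastforce simp: simplicial_complex_def order_complex_def Complete_Partial_Order.chain_def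
      intro: finite_subset[OF _ iffD2[OF finite_Pow_iff]])

definition graded_poset :: "'a::order set \<Rightarrow> nat \<Rightarrow> bool" where
  "graded_poset P d \<longleftrightarrow>
     finite P \<and> pure_complex (order_complex P) \<and> complex_dim (order_complex P) = int d"

definition maximal_elements :: "'a::order set \<Rightarrow> 'a set" where
  "maximal_elements P = {y \<in> P. \<forall>x\<in>P. y \<le> x \<longrightarrow> x = y}"

definition open_interval :: "'a::order set \<Rightarrow> 'a \<Rightarrow> 'a \<Rightarrow> 'a set" where
  "open_interval P a b = {x \<in> P. a < x \<and> x < b}"

definition poset_cohen_macaulay :: "'k::field itself \<Rightarrow> 'a::order set \<Rightarrow> bool" where
  "poset_cohen_macaulay k P \<longleftrightarrow> cohen_macaulay k (order_complex P)"

definition poset_doubly_cohen_macaulay :: "'k::field itself \<Rightarrow> 'a::order set \<Rightarrow> bool" where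
  "poset_doubly_cohen_macaulay k P \<longleftrightarrow> doubly_cohen_macaulay k (order_complex P)"

definition poset_buchsbaum :: "'k::field itself \<Rightarrow> 'a::order set \<Rightarrow> bool" where
  "poset_buchsbaum k P \<longleftrightarrow> buchsbaum k (order_complex P)"

definition poset_buchsbaum_star :: "'k::field itself \<Rightarrow> 'a::order set \<Rightarrow> bool" where
  "poset_buchsbaum_star k P \<longleftrightarrow> buchsbaum_star k (order_complex P)"

end

theory Submission
  imports Defs "HOL-Library.Function_Algebras"
begin

text \<open>Let \<open>\<Delta>\<close> be the order complex of the proper part of \<open>P\<close> and \<open>\<Gamma>\<close> its subcomplex of faces without
  maximal elements.  Every facet of \<open>\<Delta>\<close> contains exactly one maximal element, so a chain \<open>b\<close> of
  \<open>\<Delta>\<close> is \<open>b\<^sub>0 + \<Sum> y * b\<^sub>y\<close> with \<open>b\<^sub>0\<close> in \<open>\<Gamma>\<close>; if the boundary of \<open>b\<close> lies in \<open>\<Gamma>\<close>, every \<open>b\<^sub>y\<close> is a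
  cycle in the link of \<open>y\<close> and may be filled there, which replaces \<open>b\<close> by a chain of \<open>\<Gamma>\<close> with the
  same boundary.  This shows that the links of \<open>\<Gamma>\<close> inherit the vanishing of homology from those of
  \<open>\<Delta>\<close>.  A cycle in the link of a vertex \<open>x\<close> of \<open>\<Gamma>\<close> even bounds in \<open>\<Gamma>\<close> away from \<open>x\<close>: fill it in the
  link of \<open>x\<close> in \<open>\<Delta>\<close> and refill the \<open>b\<^sub>y\<close>, whose fillings may avoid \<open>x\<close> as the link of \<open>y\<close> is doubly
  Cohen-Macaulay.  Both claims apply to all links of \<open>\<Gamma>\<close> as well; they give acyclicity of \<open>\<Gamma> - x\<close>
  below the top degree, and the lifting of relative cycles required of a Buchsbaum* complex by
  adding one vertex of the given face at a time.\<close>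


section \<open>Contractions, cones and the boundary\<close>

text \<open>The boundary is the sum of the contractions with all vertices.  These anticommute, as
  interior products do, and \<open>cone v\<close> is the exterior multiplication by \<open>v\<close>.\<close>

definition is_chain :: "int \<Rightarrow> 'a set set \<Rightarrow> ('a set \<Rightarrow> 'k::field) \<Rightarrow> bool" where
  "is_chain i K c \<longleftrightarrow> (\<forall>s. c s \<noteq> 0 \<longrightarrow> s \<in> K \<and> int (card s) = i + 1)"

definition incidence :: "'a \<Rightarrow> 'a set \<Rightarrow> 'k::field" where
  "incidence v t = (- 1) ^ card {u \<in> t. (u, v) \<in> vertex_order}"

definition contract :: "'a \<Rightarrow> ('a set \<Rightarrow> 'k::field) \<Rightarrow> 'a set \<Rightarrow> 'k" where
  "contract v c t = (if v \<in> t then 0 else incidence v t * c (insert v t))"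

definition cone :: "'a \<Rightarrow> ('a set \<Rightarrow> 'k::field) \<Rightarrow> 'a set \<Rightarrow> 'k" where
  "cone v c t = (if v \<in> t then incidence v (t - {v}) * c (t - {v}) else 0)"

text \<open>Used with a finite \<open>V\<close>. This excludes infinite sets, on which
  \<open>card\<close> and hence the signs are meaningless, and it lets the boundary be summed over a
  set that is the same for all chains involved.\<close>

definition supported_on :: "'a set \<Rightarrow> ('a set \<Rightarrow> 'k::field) \<Rightarrow> bool" where
  "supported_on V c \<longleftrightarrow> (\<forall>s. c s \<noteq> 0 \<longrightarrow> s \<subseteq> V)"

lemma sum_fun_apply: "(\<Sum>a\<in>A. f a) x = (\<Sum>a\<in>A. f a x)"
  by (induction A rule: infinite_finite_induct) auto

section \<open>Signs and anticommutation\<close>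

lemma incidence_insert:
  assumes "finite t" "u \<notin> t"
  shows "(incidence v (insert u t) :: 'k::field) =
    (if (u, v) \<in> vertex_order then - incidence v t else incidence v t)"
proof -
  have "{w \<in> insert u t. (w, v) \<in> vertex_order} =
      (if (u, v) \<in> vertex_order then insert u {w \<in> t. (w, v) \<in> vertex_order}
       else {w \<in> t. (w, v) \<in> vertex_order})"
    by auto
  then show ?thesis
    using assms by (simp add: incidence_def)
qed

lemma incidence_square [simp]: "(incidence v t :: 'k::field) * incidence v t = 1"
  by (simp add: incidence_def flip: power_add mult_2)

lemma vertex_order_flip: "u \<noteq> v \<Longrightarrow> (u, v) \<in> vertex_order \<longleftrightarrow> (v, u) \<notin> vertex_order"
  using linear_order_vertex_order
  by (auto simp: linear_order_on_def partial_order_on_def total_on_def antisym_def)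

text \<open>Both sides read the coefficient of the same face. Exactly one of two distinct vertices
  precedes the other, so exactly one of the incidence signs flips. For \<open>u = v\<close> both
  sides vanish.\<close>

lemma contract_contract:
  assumes "finite V" "supported_on V c"
  shows "contract u (contract v c) = - contract v (contract u c)"
proof
  fix t
  show "contract u (contract v c) t = (- contract v (contract u c)) t"
  proof (cases "finite t \<and> u \<noteq> v \<and> u \<notin> t \<and> v \<notin> t")
    case True
    then show ?thesis
      using vertex_order_flip[of u v]
      by (auto simp: contract_def incidence_insert insert_commute)
  next
    case False
    have "c (insert u (insert v t)) = 0" if "infinite t"
      using assms that by (meson finite_insert finite_subset supported_on_def)
    then show ?thesis
      using False by (auto simp: contract_def insert_commute)
  qed
qed

lemma contract_self [simp]: "contract v (contract v c) = 0"
  by (auto simp: contract_def)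

lemma contract_cone:
  assumes "finite V" "supported_on V c" "u \<noteq> v"
  shows "contract u (cone v c) = - cone v (contract u c)"
proof
  fix t
  show "contract u (cone v c) t = (- cone v (contract u c)) t"
  proof (cases "finite t \<and> u \<notin> t \<and> v \<in> t")
    case True
    define r where "r = t - {v}"
    have r: "t = insert v r" "v \<notin> r" "finite r" "u \<notin> r"
      using True by (auto simp: r_def)
    have "insert u (insert v r) - {v} = insert u r" "insert v r - {v} = r"
      using r assms by auto
    then show ?thesis
      using vertex_order_flip[OF \<open>u \<noteq> v\<close>] r assms(3)
      by (auto simp: contract_def cone_def incidence_insert mult_ac)
  next
    case False
    have "c (insert u (t - {v})) = 0" "c (insert u t - {v}) = 0" if "infinite t"
      using assms that by (meson finite_insert finite_Diff2 finite.emptyI finite_subset supported_on_def)+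
    then show ?thesis
      using False assms(3) by (auto simp: contract_def cone_def)
  qed
qed

lemma contract_cone_self: "contract v (cone v c) t = (if v \<in> t then 0 else c t)"
  by (auto simp: contract_def cone_def)

text \<open>The projection onto the faces containing \<open>v\<close>. The summands
  \<open>y * b_y\<close> of a chain are expressed in this way.\<close>

lemma cone_contract_self: "cone v (contract v c) t = (if v \<in> t then c t else 0)"
  by (auto simp: contract_def cone_def insert_absorb)

section \<open>Linearity and supports\<close>

lemma contract_add: "contract v (a + b) = contract v a + contract v b"
  and contract_diff: "contract v (a - b) = contract v a - contract v b"
  and contract_sum: "contract v (\<Sum>i\<in>I. f i) = (\<Sum>i\<in>I. contract v (f i))"
  and cone_zero [simp]: "cone v 0 = 0"
  and cone_sum: "cone v (\<Sum>i\<in>I. f i) = (\<Sum>i\<in>I. cone v (f i))"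
  by (auto simp: fun_eq_iff contract_def cone_def sum_fun_apply algebra_simps sum_distrib_left)

lemma supported_on_add: "supported_on V a \<Longrightarrow> supported_on V b \<Longrightarrow> supported_on V (a + b)"
  and supported_on_diff: "supported_on V a \<Longrightarrow> supported_on V b \<Longrightarrow> supported_on V (a - b)"
  and supported_on_contract: "supported_on V a \<Longrightarrow> supported_on V (contract v a)"
  and supported_on_cone: "v \<in> V \<Longrightarrow> supported_on V a \<Longrightarrow> supported_on V (cone v a)"
  unfolding supported_on_def contract_def cone_def plus_fun_def fun_diff_def
  by (auto split: if_splits) (metis add_0 subsetD | metis diff_zero diff_self subsetD | blast)+

lemma supported_on_sum: "(\<And>i. i \<in> I \<Longrightarrow> supported_on V (f i)) \<Longrightarrow> supported_on V (\<Sum>i\<in>I. f i)"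
  unfolding supported_on_def by (metis sum.neutral sum_fun_apply)

lemma boundary_eq_sum_contract:
  assumes "finite V" "supported_on V c"
  shows "boundary c = (\<Sum>v\<in>V. contract v c)"
proof
  fix t
  have "boundary c t = (\<Sum>v\<in>{v. v \<notin> t \<and> c (insert v t) \<noteq> 0}. contract v c t)"
    by (auto simp: boundary_def contract_def incidence_def)
  also have "\<dots> = (\<Sum>v\<in>V. contract v c t)"
    using assms by (intro sum.mono_neutral_left) (auto simp: supported_on_def contract_def)
  finally show "boundary c t = (\<Sum>v\<in>V. contract v c) t"
    by (simp add: sum_fun_apply)
qed

lemma boundary_add:
  assumes "finite V" "supported_on V a" "supported_on V b"
  shows "boundary (a + b) = boundary a + boundary b"
  using assms by (simp add: boundary_eq_sum_contract[of V] supported_on_add contract_add sum.distrib)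

lemma boundary_diff:
  assumes "finite V" "supported_on V a" "supported_on V b"
  shows "boundary (a - b) = boundary a - boundary b"
  using assms by (simp add: boundary_eq_sum_contract[of V] supported_on_diff contract_diff sum_subtractf)

lemma boundary_zero [simp]: "boundary 0 = 0"
  by (auto simp: boundary_def fun_eq_iff)

lemma boundary_sum:
  assumes "finite V" "\<And>i. i \<in> I \<Longrightarrow> supported_on V (f i)"
  shows "boundary (\<Sum>i\<in>I. f i) = (\<Sum>i\<in>I. boundary (f i))"
  using assms(2)
proof (induction I rule: infinite_finite_induct)
  case (insert i I)
  have "boundary (f i + (\<Sum>i\<in>I. f i)) = boundary (f i) + boundary (\<Sum>i\<in>I. f i)"
    using insert by (intro boundary_add[OF assms(1)] supported_on_sum) auto
  then show ?case
    using insert.IH[OF insert.prems] by (simp only: sum.insert[OF insert.hyps] insertI2)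
qed (simp_all only: sum.infinite sum.empty boundary_zero simp_thms)

lemma supported_on_boundary:
  assumes "finite V" "supported_on V c"
  shows "supported_on V (boundary c)"
  using assms by (simp add: boundary_eq_sum_contract supported_on_sum supported_on_contract)

text \<open>\<open>contract v\<close> anticommutes with every summand of the boundary. In
  particular, contracting a cycle yields a cycle.\<close>

lemma boundary_contract:
  assumes "finite V" "supported_on V c"
  shows "boundary (contract v c) = - contract v (boundary c)"
proof -
  have "boundary (contract v c) = (\<Sum>u\<in>V. contract u (contract v c))"
    by (rule boundary_eq_sum_contract[OF assms(1) supported_on_contract[OF assms(2)]])
  also have "\<dots> = (\<Sum>u\<in>V. - contract v (contract u c))"
    by (intro sum.cong refl contract_contract[OF assms])
  also have "\<dots> = - contract v (boundary c)"
    using assms by (simp add: boundary_eq_sum_contract[of V] contract_sum sum_negf)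
  finally show ?thesis .
qed

text \<open>The cone formula: the summands for \<open>u\<close> other than \<open>v\<close>
  anticommute with \<open>cone v\<close>, and the summand for \<open>v\<close> is treated
  separately.\<close>

lemma boundary_cone:
  assumes "finite V" "supported_on V c" "v \<in> V"
  shows "boundary (cone v c) = c - cone v (boundary c)"
proof -
  have "boundary (cone v c) = contract v (cone v c) + (\<Sum>u\<in>V-{v}. contract u (cone v c))"
    using assms by (simp add: boundary_eq_sum_contract[of V] supported_on_cone sum.remove)
  also have "(\<Sum>u\<in>V-{v}. contract u (cone v c)) = (\<Sum>u\<in>V-{v}. - cone v (contract u c))"
    using contract_cone[OF assms(1,2)] by (intro sum.cong) auto
  also have "\<dots> = - cone v (\<Sum>u\<in>V-{v}. contract u c)"
    by (simp add: cone_sum sum_negf)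
  also have "(\<Sum>u\<in>V-{v}. contract u c) = boundary c - contract v c"
    using assms by (simp add: boundary_eq_sum_contract[of V] sum.remove)
  \<comment> \<open>The projections onto the faces avoiding \<open>v\<close> and onto those
    containing \<open>v\<close> add up to the identity.\<close>
  also have "contract v (cone v c) + - cone v (boundary c - contract v c) = c - cone v (boundary c)"
  proof
    fix t
    have "cone v (boundary c - contract v c) t = cone v (boundary c) t - cone v (contract v c) t"
      by (simp add: cone_def algebra_simps)
    then show "(contract v (cone v c) + - cone v (boundary c - contract v c)) t =
        (c - cone v (boundary c)) t"
      by (simp add: contract_cone_self cone_contract_self)
  qed
  finally show ?thesis .
qed

lemma boundary_boundary:
  assumes "finite V" "supported_on V c"
  shows "boundary (boundary c) = 0"
proof -
  \<comment> \<open>A sum of anticommuting maps of square zero has square zero. Stated for every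
    finite \<open>W\<close>, so that vertices can be added one at a time; the mixed terms with
    \<open>w\<close> cancel.\<close>
  have "(\<Sum>u\<in>W. contract u (\<Sum>v\<in>W. contract v c)) = 0" if "finite W" for W
    using that
  proof induction
    case (insert w W)
    have "(\<Sum>u\<in>W. contract u (contract w c)) = - contract w (\<Sum>v\<in>W. contract v c)"
      using assms by (simp add: contract_contract[of V c _ w] contract_sum sum_negf)
    with insert.IH show ?case
      by (simp only: sum.insert[OF insert.hyps] contract_add sum.distrib contract_self) simp
  qed simp
  with assms show ?thesis
    by (simp add: boundary_eq_sum_contract[of V] supported_on_boundary supported_on_sum supported_on_contract)
qed


section \<open>Links, deletions and chains\<close>

lemma mem_link: "u \<in> link K s \<longleftrightarrow> u \<inter> s = {} \<and> u \<union> s \<in> K"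
proof
  assume "u \<in> link K s"
  then obtain t where "u = t - s" "s \<subseteq> t" "t \<in> K"
    by (auto simp: link_def)
  moreover from this have "u \<union> s = t"
    by auto
  ultimately show "u \<inter> s = {} \<and> u \<union> s \<in> K"
    by auto
next
  assume "u \<inter> s = {} \<and> u \<union> s \<in> K"
  then show "u \<in> link K s"
    unfolding link_def by (intro CollectI exI[of _ "u \<union> s"]) auto
qed

lemma mem_link_singleton: "u \<in> link K {v} \<longleftrightarrow> v \<notin> u \<and> insert v u \<in> K"
  by (simp add: mem_link)

lemma mem_deletion: "t \<in> deletion K v \<longleftrightarrow> t \<in> K \<and> v \<notin> t"
  by (simp add: deletion_def)

lemma deletion_subset: "deletion K v \<subseteq> K"
  by (auto simp: deletion_def)

lemma link_empty [simp]: "link K {} = K"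
  by (auto simp: mem_link)

lemma link_link: "s \<inter> r = {} \<Longrightarrow> link (link K s) r = link K (s \<union> r)"
  by (auto simp: mem_link Int_Un_distrib Int_Un_distrib2 Un_ac Int_commute)

lemma link_deletion: "v \<notin> s \<Longrightarrow> link (deletion K v) s = deletion (link K s) v"
  by (auto simp: mem_link mem_deletion)

lemma simplicial_complexD:
  assumes "simplicial_complex K"
  shows "finite K" "{} \<in> K" "s \<in> K \<Longrightarrow> finite s" "s \<in> K \<Longrightarrow> t \<subseteq> s \<Longrightarrow> t \<in> K" "finite (\<Union>K)"
  using assms by (auto simp: simplicial_complex_def)

lemma simplicial_complex_link:
  assumes "simplicial_complex K" "s \<in> K"
  shows "simplicial_complex (link K s)"
proof -
  have sub: "link K s \<subseteq> K"
    using simplicial_complexD(4)[OF assms(1)] by (auto simp: mem_link)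
  have "t \<in> link K s" if "t \<subseteq> u" "u \<in> link K s" for t u
    using that simplicial_complexD(4)[OF assms(1), of "u \<union> s" "t \<union> s"] by (auto simp: mem_link)
  then show ?thesis
    using assms simplicial_complexD[OF assms(1)] sub
    by (auto simp: simplicial_complex_def mem_link dest: finite_subset)
qed

lemma simplicial_complex_deletion:
  assumes "simplicial_complex K"
  shows "simplicial_complex (deletion K v)"
  using assms by (auto simp: simplicial_complex_def deletion_def)

lemma link_subset: "simplicial_complex K \<Longrightarrow> link K s \<subseteq> K"
  using simplicial_complexD(4) by (fastforce simp: mem_link)

lemma link_singleton_subset_deletion: "simplicial_complex K \<Longrightarrow> link K {v} \<subseteq> deletion K v"
  using link_subset[of K "{v}"] by (auto simp: mem_link mem_deletion)

section \<open>Closure properties of chains\<close>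

lemma is_chain_mono: "is_chain i K c \<Longrightarrow> K \<subseteq> L \<Longrightarrow> is_chain i L c"
  by (auto simp: is_chain_def)

lemma is_chain_supported_on: "is_chain i K c \<Longrightarrow> \<Union>K \<subseteq> V \<Longrightarrow> supported_on V c"
  by (auto simp: is_chain_def supported_on_def)

lemma is_chain_zero [simp]: "is_chain i K 0"
  by (simp add: is_chain_def)

lemma is_chain_add: "is_chain i K a \<Longrightarrow> is_chain i K b \<Longrightarrow> is_chain i K (a + b)"
  unfolding is_chain_def plus_fun_def by (metis add_0)

lemma is_chain_uminus: "is_chain i K a \<Longrightarrow> is_chain i K (- a)"
  unfolding is_chain_def by simp

lemma is_chain_diff: "is_chain i K a \<Longrightarrow> is_chain i K b \<Longrightarrow> is_chain i K (a - b)"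
  using is_chain_add[of i K a "- b"] is_chain_uminus[of i K b] by simp

lemma is_chain_sum: "(\<And>j. j \<in> J \<Longrightarrow> is_chain i K (f j)) \<Longrightarrow> is_chain i K (\<Sum>j\<in>J. f j)"
  unfolding is_chain_def by (metis sum.neutral sum_fun_apply)

lemma is_chain_contract:
  assumes "is_chain (i + 1) K c" "simplicial_complex K"
  shows "is_chain i (link K {v}) (contract v c)"
  unfolding is_chain_def
proof (intro allI impI)
  fix s
  assume "contract v c s \<noteq> 0"
  then have s: "v \<notin> s" "c (insert v s) \<noteq> 0"
    by (auto simp: contract_def split: if_splits)
  then have "insert v s \<in> K" "int (card (insert v s)) = i + 2"
    using assms(1) by (auto simp: is_chain_def)
  moreover from this have "finite s"
    using simplicial_complexD(3)[OF assms(2)] by fastforce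
  ultimately show "s \<in> link K {v} \<and> int (card s) = i + 1"
    using s by (simp add: mem_link_singleton)
qed

lemma is_chain_cone:
  assumes "is_chain i (link K {v}) a" "simplicial_complex K"
  shows "is_chain (i + 1) K (cone v a)"
  unfolding is_chain_def
proof (intro allI impI)
  fix s
  assume "cone v a s \<noteq> 0"
  then have s: "v \<in> s" "a (s - {v}) \<noteq> 0"
    by (auto simp: cone_def split: if_splits)
  then have "insert v (s - {v}) \<in> K" "int (card (s - {v})) = i + 1"
    using assms(1) by (auto simp: is_chain_def mem_link_singleton)
  moreover have "insert v (s - {v}) = s"
    using s by (simp add: insert_absorb)
  ultimately have "s \<in> K" "int (card (s - {v})) = i + 1"
    by simp_all
  moreover have "card s = Suc (card (s - {v}))"
    using s simplicial_complexD(3)[OF assms(2) \<open>s \<in> K\<close>] by (metis card.remove)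
  ultimately show "s \<in> K \<and> int (card s) = i + 1 + 1"
    by simp
qed

section \<open>Filling cycles\<close>

text \<open>The refilling step. The target \<open>N\<close> is kept separate from \<open>K\<close>,
  because the result is needed both for a link in the lower complex and for a deletion of such a
  link. By \<open>le1\<close>, every face of \<open>K\<close> meeting \<open>M\<close> belongs to
  exactly one vertex of \<open>M\<close>.\<close>

lemma boundary_remove_vertices:
  fixes f :: "'a set \<Rightarrow> 'k::field"
  assumes K: "simplicial_complex K" and N: "finite (\<Union>N)"
    and le1: "\<And>s x y. s \<in> K \<Longrightarrow> x \<in> s \<inter> M \<Longrightarrow> y \<in> s \<inter> M \<Longrightarrow> x = y"
    and f: "is_chain (i + 1) K f" "\<And>t. boundary f t \<noteq> 0 \<Longrightarrow> t \<inter> M = {}"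
    and fill: "\<And>y a :: 'a set \<Rightarrow> 'k. y \<in> M \<Longrightarrow> is_chain i (link K {y}) a \<Longrightarrow> boundary a = 0 \<Longrightarrow>
      \<exists>e. is_chain (i + 1) N e \<and> boundary e = a"
    and sub: "{s \<in> K. s \<inter> M = {}} \<subseteq> N"
  shows "\<exists>h. is_chain (i + 1) N h \<and> boundary h = boundary f"
proof -
  define V where "V = \<Union>K \<union> \<Union>N"
  have V: "finite V"
    using N simplicial_complexD(5)[OF K] by (simp add: V_def)
  have fV: "supported_on V f"
    using is_chain_supported_on[OF f(1)] by (auto simp: V_def)
  have lk: "is_chain i (link K {y}) (contract y f)" for y
    by (rule is_chain_contract[OF f(1) K])
  have cyc: "boundary (contract y f) = 0" if "y \<in> M" for y
  proof -
    have "contract y (boundary f) = 0"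
      using f(2) that by (force simp: contract_def fun_eq_iff)
    then show ?thesis
      using boundary_contract[OF V fV, of y] by simp
  qed
  obtain e where e: "\<And>y. y \<in> M \<Longrightarrow> is_chain (i + 1) N (e y)"
      "\<And>y. y \<in> M \<Longrightarrow> boundary (e y) = contract y f"
    using fill[OF _ lk cyc] by metis
  \<comment> \<open>\<open>M\<close> may be infinite; only its vertices in \<open>V\<close> can
    occur in \<open>f\<close>.\<close>
  define I where "I = M \<inter> V"
  have I: "I \<subseteq> M" "I \<subseteq> V" "finite I"
    using V by (auto simp: I_def)
  define f0 where "f0 = f - (\<Sum>y\<in>I. cone y (contract y f))"
  \<comment> \<open>A face meeting \<open>M\<close> contains exactly one element of
    \<open>I\<close>, so its coefficient is subtracted exactly once.\<close>
  have f0_eq: "f0 t = (if t \<inter> M = {} then f t else 0)" for t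
  proof -
    have *: "f0 t = f t - (\<Sum>y\<in>I. if y \<in> t then f t else 0)"
      by (simp add: f0_def sum_fun_apply cone_contract_self)
    show ?thesis
    proof (cases "t \<inter> M = {} \<or> f t = 0")
      case True
      then have "(\<Sum>y\<in>I. if y \<in> t then f t else 0) = 0"
        using I by (intro sum.neutral) auto
      with True * show ?thesis
        by auto
    next
      case False
      then obtain y where y: "y \<in> t \<inter> M" "t \<in> K"
        using f(1) by (auto simp: is_chain_def)
      then have "x \<in> t \<longleftrightarrow> x = y" if "x \<in> I" for x
        using le1[OF y(2) _ y(1), of x] that I by auto
      then have "(\<Sum>x\<in>I. if x \<in> t then f t else 0) = (\<Sum>x\<in>I. if x = y then f t else 0)"
        by (intro sum.cong) auto
      moreover have "y \<in> I"
        using y by (auto simp: I_def V_def)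
      ultimately show ?thesis
        using * y I by (auto simp: sum.delta)
    qed
  qed
  have f0: "is_chain (i + 1) N f0"
    using f(1) sub by (auto simp: is_chain_def f0_eq)
  have "supported_on V (cone y (contract y f))" if "y \<in> I" for y
    using that I fV by (intro supported_on_cone supported_on_contract) auto
  then have "boundary f0 = boundary f - (\<Sum>y\<in>I. boundary (cone y (contract y f)))"
    unfolding f0_def by (simp add: boundary_diff[OF V fV] supported_on_sum boundary_sum[OF V])
  also have "(\<Sum>y\<in>I. boundary (cone y (contract y f))) = (\<Sum>y\<in>I. contract y f)"
  proof (intro sum.cong refl)
    fix y assume "y \<in> I"
    then have "y \<in> M" "y \<in> V"
      using I by auto
    then show "boundary (cone y (contract y f)) = contract y f"
      using boundary_cone[OF V supported_on_contract[OF fV]] cyc by simp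
  qed
  finally have b0: "boundary f0 = boundary f - (\<Sum>y\<in>I. contract y f)" .
  \<comment> \<open>The boundary of \<open>f0\<close> differs from that of \<open>f\<close> by the
    cycles \<open>contract y f\<close>, and the fillings \<open>e y\<close> make up for
    them.\<close>
  define h where "h = f0 + (\<Sum>y\<in>I. e y)"
  have eV: "supported_on V (e y)" if "y \<in> I" for y
    using is_chain_supported_on[OF e(1)] that I by (auto simp: V_def)
  have "supported_on V f0"
    using is_chain_supported_on[OF f0] by (auto simp: V_def)
  then have "boundary h = boundary f0 + (\<Sum>y\<in>I. boundary (e y))"
    using eV by (simp add: h_def boundary_add[OF V] boundary_sum[OF V] supported_on_sum)
  also have "(\<Sum>y\<in>I. boundary (e y)) = (\<Sum>y\<in>I. contract y f)"
    using e(2) I by (intro sum.cong) auto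
  finally have "boundary h = boundary f"
    using b0 by simp
  moreover have "is_chain (i + 1) N h"
    unfolding h_def using e(1) I by (intro is_chain_add f0 is_chain_sum) auto
  ultimately show ?thesis
    by blast
qed

text \<open>Vanishing of reduced homology in degree \<open>i\<close>, phrased without quotient
  groups; see \<open>trivial_reduced_homology_iff\<close>.\<close>

definition exact_at :: "'k::field itself \<Rightarrow> int \<Rightarrow> 'a set set \<Rightarrow> bool" where
  "exact_at k i K \<longleftrightarrow>
     (\<forall>c :: 'a set \<Rightarrow> 'k. is_chain i K c \<longrightarrow> boundary c = 0 \<longrightarrow>
        (\<exists>b. is_chain (i + 1) K b \<and> boundary b = c))"

lemma exact_atD:
  fixes k :: "'k::field itself" and c :: "'a set \<Rightarrow> 'k"
  assumes "exact_at k i K" "is_chain i K c" "boundary c = 0"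
  obtains b where "is_chain (i + 1) K b" "boundary b = c"
  using assms unfolding exact_at_def by blast

text \<open>If \<open>b\<close> fills a cycle \<open>c\<close> avoiding \<open>x\<close>, its part \<open>b - cone x (contract x b)\<close> avoiding \<open>x\<close> has
  boundary \<open>c - contract x b\<close>, and the cycle \<open>contract x b\<close> of the link is filled separately.\<close>

lemma exact_at_deletion:
  fixes k :: "'k::field itself"
  assumes K: "simplicial_complex K" and ex: "exact_at k i K"
    and fill: "\<And>a :: 'a set \<Rightarrow> 'k. is_chain i (link K {x}) a \<Longrightarrow> boundary a = 0 \<Longrightarrow>
      \<exists>e. is_chain (i + 1) (deletion K x) e \<and> boundary e = a"
  shows "exact_at k i (deletion K x)"
proof (cases "{x} \<in> K")
  case False
  have "x \<notin> s" if "s \<in> K" for s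
    using simplicial_complexD(4)[OF K that, of "{x}"] False by auto
  then have "deletion K x = K"
    by (auto simp: mem_deletion)
  with ex show ?thesis
    by simp
next
  case True
  show ?thesis
    unfolding exact_at_def
  proof (intro allI impI)
    fix c :: "'a set \<Rightarrow> 'k"
    assume c: "is_chain i (deletion K x) c" "boundary c = 0"
    obtain b where b: "is_chain (i + 1) K b" "boundary b = c"
      using exact_atD[OF ex is_chain_mono[OF c(1) deletion_subset] c(2)] by blast
    note V = simplicial_complexD(5)[OF K]
    have bV: "supported_on (\<Union>K) b"
      by (rule is_chain_supported_on[OF b(1) order_refl])
    have lk: "is_chain i (link K {x}) (contract x b)"
      by (rule is_chain_contract[OF b(1) K])
    have "contract x c = 0"
      using c(1) by (force simp: contract_def is_chain_def mem_deletion fun_eq_iff)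
    then have cyc: "boundary (contract x b) = 0"
      using boundary_contract[OF V bV, of x] b(2) by simp
    obtain e where e: "is_chain (i + 1) (deletion K x) e" "boundary e = contract x b"
      using fill[OF lk cyc] by blast
    define b0 where "b0 = b - cone x (contract x b)"
    have b0: "is_chain (i + 1) (deletion K x) b0"
      using b(1) by (auto simp: is_chain_def b0_def cone_contract_self mem_deletion split: if_splits)
    have x: "x \<in> \<Union>K"
      using True by auto
    have "boundary b0 = c - contract x b"
      unfolding b0_def
      using boundary_diff[OF V bV supported_on_cone[OF x supported_on_contract[OF bV]]]
        boundary_cone[OF V supported_on_contract[OF bV] x] cyc b(2) by simp
    moreover have "supported_on (\<Union>K) e" "supported_on (\<Union>K) b0"
      using e(1) b0 by (auto elim!: is_chain_supported_on simp: mem_deletion)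
    ultimately have "boundary (b0 + e) = c"
      using e(2) by (simp add: boundary_add[OF V])
    then show "\<exists>b. is_chain (i + 1) (deletion K x) b \<and> boundary b = c"
      using is_chain_add[OF b0 e(1)] by blast
  qed
qed


section \<open>Dimension\<close>

lemma complex_dim_eqI:
  assumes "finite K" "t \<in> K" "card t = n" "\<And>s. s \<in> K \<Longrightarrow> card s \<le> n"
  shows "complex_dim K = int n - 1"
proof -
  have "Max (card ` K) = n"
    using assms by (intro Max_eqI) auto
  then show ?thesis
    by (simp add: complex_dim_def)
qed

lemma card_le_complex_dim:
  assumes "simplicial_complex K" "s \<in> K"
  shows "int (card s) \<le> complex_dim K + 1"
  using assms simplicial_complexD(1)[OF assms(1)] by (simp add: complex_dim_def)

lemma obtain_top_face:
  assumes "simplicial_complex K"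
  obtains t where "t \<in> K" "int (card t) = complex_dim K + 1"
proof -
  have "Max (card ` K) \<in> card ` K"
    using simplicial_complexD(1,2)[OF assms] by (intro Max_in) auto
  then show ?thesis
    using that by (auto simp: complex_dim_def)
qed

text \<open>Purity of dimension \<open>n - 1\<close>, measured by the number of vertices: passing to
  a link then subtracts a cardinality, and no facets have to be mentioned.\<close>

definition equidimensional :: "nat \<Rightarrow> 'a set set \<Rightarrow> bool" where
  "equidimensional n K \<longleftrightarrow>
     (\<forall>s\<in>K. card s \<le> n) \<and> (\<forall>s\<in>K. \<exists>t\<in>K. s \<subseteq> t \<and> card t = n)"

lemma complex_dim_equidimensional:
  assumes "simplicial_complex K" "equidimensional n K"
  shows "complex_dim K = int n - 1"
  using assms simplicial_complexD(1,2)[OF assms(1)]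
  by (metis complex_dim_eqI equidimensional_def)

lemma equidimensional_link:
  assumes K: "simplicial_complex K" and n: "equidimensional n K" and s: "s \<in> K"
  shows "equidimensional (n - card s) (link K s)"
proof -
  have fs: "finite s"
    using simplicial_complexD(3)[OF K s] .
  have un: "card (u \<union> s) = card u + card s" if "u \<in> link K s" for u
    using that simplicial_complexD(3)[OF K, of "u \<union> s"] by (simp add: mem_link card_Un_disjoint)
  have "card u \<le> n - card s" if "u \<in> link K s" for u
    using un[OF that] that n by (auto simp: mem_link equidimensional_def le_diff_conv2)
  moreover have "\<exists>t\<in>link K s. u \<subseteq> t \<and> card t = n - card s" if u: "u \<in> link K s" for u
  proof -
    obtain t where t: "t \<in> K" "u \<union> s \<subseteq> t" "card t = n"
      using n u by (auto simp: mem_link equidimensional_def)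
    then have "t - s \<in> link K s"
      by (auto simp: link_def)
    moreover have "u \<subseteq> t - s" "card (t - s) = n - card s"
      using t u fs by (auto simp: mem_link card_Diff_subset)
    ultimately show ?thesis
      by blast
  qed
  ultimately show ?thesis
    by (simp add: equidimensional_def)
qed

lemma complex_dim_link:
  assumes "simplicial_complex K" "equidimensional n K" "s \<in> K"
  shows "complex_dim (link K s) = int n - int (card s) - 1"
proof -
  have "card s \<le> n"
    using assms by (auto simp: equidimensional_def)
  then show ?thesis
    using complex_dim_equidimensional[OF simplicial_complex_link[OF assms(1,3)] equidimensional_link[OF assms]]
    by (simp add: of_nat_diff)
qed

lemma pure_complex_iff_equidimensional:
  assumes K: "simplicial_complex K"
  shows "pure_complex K \<and> complex_dim K = int n - 1 \<longleftrightarrow> equidimensional n K"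
proof
  assume *: "pure_complex K \<and> complex_dim K = int n - 1"
  have "\<exists>t\<in>K. s \<subseteq> t \<and> card t = n" if s: "s \<in> K" for s
  proof -
    obtain t where t: "t \<in> K" "s \<subseteq> t" "\<forall>u\<in>K. t \<subseteq> u \<longrightarrow> u = t"
      using finite_has_maximal2[OF simplicial_complexD(1)[OF K] s] by metis
    then have "int (card t) - 1 = complex_dim K"
      using * by (auto simp: pure_complex_def facets_def)
    with * t show ?thesis
      by auto
  qed
  moreover have "card s \<le> n" if "s \<in> K" for s
    using card_le_complex_dim[OF K that] * by simp
  ultimately show "equidimensional n K"
    by (simp add: equidimensional_def)
next
  assume *: "equidimensional n K"
  then have "card s = n" if "s \<in> facets K" for s
    using that by (auto simp: facets_def equidimensional_def)
  then show "pure_complex K \<and> complex_dim K = int n - 1"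
    using complex_dim_equidimensional[OF K *] by (simp add: pure_complex_def)
qed

section \<open>Homology in terms of chains\<close>

lemma mem_carrier_chain_group: "c \<in> carrier (chain_group k i K) \<longleftrightarrow> is_chain i K c"
  by (simp add: chain_group_def is_chain_def)

lemma is_chain_void: "is_chain i {} c \<longleftrightarrow> c = 0"
  by (auto simp: is_chain_def)

lemma rel_cycles_eq:
  "rel_cycles k i K L = {c. is_chain i K c \<and> is_chain (i - 1) L (boundary c)}"
  by (simp add: rel_cycles_def mem_carrier_chain_group)

lemma mult_chain_group: "a \<otimes>\<^bsub>chain_group k i K\<^esub> b = a + b"
  by (simp add: chain_group_def plus_fun_def)

lemma r_coset_chain_group: "B #>\<^bsub>chain_group k i K\<^esub> c = (\<lambda>b. b + c) ` B"
  by (auto simp: r_coset_def mult_chain_group)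

lemma set_mult_chain_group:
  "B <#>\<^bsub>chain_group k i K\<^esub> C = {b + c |b c. b \<in> B \<and> c \<in> C}"
  by (auto simp: set_mult_def mult_chain_group)

lemma rel_boundaries_eq:
  "rel_boundaries k i K L = {boundary b + c |b c. is_chain (i + 1) K b \<and> is_chain i L c}"
proof -
  have *: "boundary ` carrier (chain_group k (i + 1) K) = {boundary b |b. is_chain (i + 1) K b}"
    unfolding image_def by (simp add: mem_carrier_chain_group Bex_def conj_commute)
  show ?thesis
    unfolding rel_boundaries_def set_mult_chain_group mem_carrier_chain_group * by blast
qed

lemma carrier_rel_homology:
  "carrier (rel_homology k i K L) =
     {(\<lambda>b. b + c) ` rel_boundaries k i K L |c. c \<in> rel_cycles k i K L}"
  by (auto simp: rel_homology_def FactGroup_def RCOSETS_def r_coset_chain_group)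

section \<open>Cosets of relative boundaries\<close>

lemma zero_mem_rel_boundaries [simp]: "0 \<in> rel_boundaries k i K L"
  unfolding rel_boundaries_eq by (intro CollectI exI[of _ 0]) simp

lemma rel_boundaries_add:
  assumes K: "simplicial_complex K"
    and "a \<in> rel_boundaries k i K L" "b \<in> rel_boundaries k i K L"
  shows "a + b \<in> rel_boundaries k i K L"
proof -
  obtain a1 a2 b1 b2 where *: "a = boundary a1 + a2" "b = boundary b1 + b2"
      "is_chain (i + 1) K a1" "is_chain i L a2" "is_chain (i + 1) K b1" "is_chain i L b2"
    using assms by (auto simp: rel_boundaries_eq)
  have "boundary (a1 + b1) = boundary a1 + boundary b1"
    using * by (intro boundary_add[OF simplicial_complexD(5)[OF K]])
      (auto elim: is_chain_supported_on)
  then have "a + b = boundary (a1 + b1) + (a2 + b2)"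
    using * by (simp add: ac_simps)
  then show ?thesis
    unfolding rel_boundaries_eq using is_chain_add[OF *(3,5)] is_chain_add[OF *(4,6)] by blast
qed

lemma rel_boundaries_uminus:
  assumes K: "simplicial_complex K" and "a \<in> rel_boundaries k i K L"
  shows "- a \<in> rel_boundaries k i K L"
proof -
  obtain a1 a2 where *: "a = boundary a1 + a2" "is_chain (i + 1) K a1" "is_chain i L a2"
    using assms by (auto simp: rel_boundaries_eq)
  have "boundary (0 - a1) = boundary 0 - boundary a1"
    using * by (intro boundary_diff[OF simplicial_complexD(5)[OF K]]
        is_chain_supported_on[OF _ order_refl] is_chain_zero)
  then have "- a = boundary (- a1) + - a2"
    using * by simp
  then show ?thesis
    unfolding rel_boundaries_eq using is_chain_uminus[OF *(2)] is_chain_uminus[OF *(3)] by blast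
qed

lemma coset_rel_boundaries:
  assumes K: "simplicial_complex K" and "c - c' \<in> rel_boundaries k i K L"
  shows "(\<lambda>b. b + c) ` rel_boundaries k i K L = (\<lambda>b. b + c') ` rel_boundaries k i K L"
proof -
  have *: "b + c \<in> (\<lambda>b. b + c') ` rel_boundaries k i K L"
    if "b \<in> rel_boundaries k i K L" "c - c' \<in> rel_boundaries k i K L" for b c c'
    using rel_boundaries_add[OF K that] by (intro image_eqI[of _ _ "b + (c - c')"]) simp_all
  have "c' - c \<in> rel_boundaries k i K L"
    using rel_boundaries_uminus[OF K assms(2)] by simp
  with assms(2) * show ?thesis
    by blast
qed

text \<open>The group consists of the cosets of the boundaries by cycles. The coset of
  \<open>c\<close> contains \<open>c\<close>, so it is the zero coset only if \<open>c\<close> is a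
  boundary.\<close>

lemma trivial_reduced_homology_iff:
  assumes K: "simplicial_complex K"
  shows "trivial_group (reduced_homology (k :: 'k::field itself) i K) \<longleftrightarrow> exact_at k i K"
proof -
  let ?B = "rel_boundaries k i K {}" and ?Z = "rel_cycles k i K {}"
  have Z: "c \<in> ?Z \<longleftrightarrow> is_chain i K c \<and> boundary c = 0" for c
    by (simp add: rel_cycles_eq is_chain_void)
  have B: "c \<in> ?B \<longleftrightarrow> (\<exists>b. is_chain (i + 1) K b \<and> boundary b = c)" for c
    by (auto simp: rel_boundaries_eq is_chain_void)
  have exact: "exact_at k i K \<longleftrightarrow> ?Z \<subseteq> ?B"
    by (auto simp: exact_at_def Z B subset_iff)
  let ?G = "reduced_homology k i K"
  have one: "\<one>\<^bsub>?G\<^esub> = ?B"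
    by (simp add: reduced_homology_def rel_homology_def FactGroup_def)
  have car: "carrier ?G = {(\<lambda>b. b + c) ` ?B |c. c \<in> ?Z}"
    by (simp add: reduced_homology_def carrier_rel_homology)
  show ?thesis
  proof
    assume "trivial_group ?G"
    then have car1: "carrier ?G = {?B}"
      using one by (simp add: trivial_group_def)
    have "(\<lambda>b. b + c) ` ?B = ?B" if "c \<in> ?Z" for c
    proof -
      have "(\<lambda>b. b + c) ` ?B \<in> carrier ?G"
        unfolding car using that by blast
      then show ?thesis
        unfolding car1 by simp
    qed
    moreover have "c \<in> (\<lambda>b. b + c) ` ?B" for c
      by (rule image_eqI[of _ _ 0]) simp_all
    ultimately show "exact_at k i K"
      unfolding exact by blast
  next
    assume ex: "exact_at k i K"
    have "(\<lambda>b. b + c) ` ?B = ?B" if "c \<in> ?Z" for c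
    proof -
      have "c - 0 \<in> ?B"
        using ex that exact by auto
      from coset_rel_boundaries[OF K this] show ?thesis
        by simp
    qed
    moreover have "0 \<in> ?Z"
      by (simp add: Z)
    ultimately have car1: "carrier ?G = {?B}"
      unfolding car by blast
    have mult: "x \<otimes>\<^bsub>?G\<^esub> y = {a + b |a b. a \<in> x \<and> b \<in> y}" for x y
      by (auto simp: reduced_homology_def rel_homology_def FactGroup_def set_mult_def
          chain_group_def plus_fun_def)
    \<comment> \<open>Triviality includes being a group. With a single coset as carrier, this
      reduces to the boundaries being closed under addition.\<close>
    have "{a + b |a b. a \<in> ?B \<and> b \<in> ?B} = ?B"
    proof
      show "?B \<subseteq> {a + b |a b. a \<in> ?B \<and> b \<in> ?B}"
      proof
        fix a assume "a \<in> ?B"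
        then show "a \<in> {a + b |a b. a \<in> ?B \<and> b \<in> ?B}"
          by (intro CollectI exI[of _ a] exI[of _ 0]) simp
      qed
    qed (auto intro: rel_boundaries_add[OF K])
    then have "?B \<otimes>\<^bsub>?G\<^esub> ?B = ?B"
      by (simp add: mult)
    then have "group ?G"
      by (intro groupI) (auto simp: car1 one)
    then show "trivial_group ?G"
      by (simp add: trivial_group_def car1 one)
  qed
qed

text \<open>Chains of \<open>cost K s\<close> are relative boundaries, so only the coefficients on the faces containing
  \<open>s\<close> matter.\<close>

lemma homology_map_cost_surj:
  fixes k :: "'k::field itself"
  assumes K: "simplicial_complex K"
    and lift: "\<And>c :: 'a set \<Rightarrow> 'k. is_chain n K c \<Longrightarrow> (\<And>t. s \<subseteq> t \<Longrightarrow> boundary c t = 0) \<Longrightarrow>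
      \<exists>c'. is_chain n K c' \<and> boundary c' = 0 \<and> (\<forall>t. s \<subseteq> t \<longrightarrow> c' t = c t)"
  shows "homology_map k n K (cost K s) ` carrier (reduced_homology k n K) =
    carrier (rel_homology k n K (cost K s))"
proof -
  let ?B = "rel_boundaries k n K {}" and ?R = "rel_boundaries k n K (cost K s)"
  have "?B \<subseteq> ?R"
    by (auto simp: rel_boundaries_eq is_chain_void) (metis add.right_neutral is_chain_zero)
  \<comment> \<open>Absolute boundaries are absorbed by the relative ones, so the class of
    \<open>c\<close> goes to the relative class of the same \<open>c\<close>.\<close>
  have map: "homology_map k n K (cost K s) ((\<lambda>b. b + c) ` ?B) = (\<lambda>b. b + c) ` ?R" for c
  proof -
    have "homology_map k n K (cost K s) ((\<lambda>b. b + c) ` ?B) =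
        {r + (b + c) |r b. r \<in> ?R \<and> b \<in> ?B}"
      by (auto simp: homology_map_def set_mult_chain_group)
    also have "\<dots> = (\<lambda>b. b + c) ` ?R"
    proof (intro equalityI subsetI)
      fix x assume "x \<in> {r + (b + c) |r b. r \<in> ?R \<and> b \<in> ?B}"
      then obtain r b where "x = r + (b + c)" "r \<in> ?R" "b \<in> ?R"
        using \<open>?B \<subseteq> ?R\<close> by blast
      then show "x \<in> (\<lambda>b. b + c) ` ?R"
        using rel_boundaries_add[OF K, of r] by (intro image_eqI[of _ _ "r + b"]) (simp_all add: add.assoc)
    next
      fix x assume "x \<in> (\<lambda>b. b + c) ` ?R"
      then obtain r where "x = r + c" "r \<in> ?R"
        by blast
      then show "x \<in> {r + (b + c) |r b. r \<in> ?R \<and> b \<in> ?B}"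
        by (intro CollectI exI[of _ r] exI[of _ 0]) simp
    qed
    finally show ?thesis .
  qed
  have "(\<lambda>b. b + c) ` ?R \<in> {(\<lambda>b. b + c) ` ?R |c. c \<in> rel_cycles k n K {}}"
    if c: "c \<in> rel_cycles k n K (cost K s)" for c
  proof -
    have "is_chain n K c" "\<And>t. s \<subseteq> t \<Longrightarrow> boundary c t = 0"
      using c by (auto simp: rel_cycles_eq is_chain_def cost_def)
    then obtain c' where c': "is_chain n K c'" "boundary c' = 0" "\<And>t. s \<subseteq> t \<Longrightarrow> c' t = c t"
      using lift by blast
    have "is_chain n K (c - c')"
      using \<open>is_chain n K c\<close> c'(1) by (rule is_chain_diff)
    then have "is_chain n (cost K s) (c - c')"
      using c'(3) by (auto simp: is_chain_def cost_def)
    then have "c - c' \<in> ?R"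
      unfolding rel_boundaries_eq by (intro CollectI exI[of _ 0] exI[of _ "c - c'"]) simp
    then have "(\<lambda>b. b + c) ` ?R = (\<lambda>b. b + c') ` ?R"
      by (rule coset_rel_boundaries[OF K])
    moreover have "c' \<in> rel_cycles k n K {}"
      using c' by (simp add: rel_cycles_eq)
    ultimately show ?thesis
      by blast
  qed
  moreover have "rel_cycles k n K {} \<subseteq> rel_cycles k n K (cost K s)"
    by (auto simp: rel_cycles_eq is_chain_void)
  moreover have "homology_map k n K (cost K s) ` carrier (reduced_homology k n K) =
      {(\<lambda>b. b + c) ` ?R |c. c \<in> rel_cycles k n K {}}"
    unfolding reduced_homology_def carrier_rel_homology by (auto simp: map image_iff) (metis map)
  ultimately show ?thesis
    unfolding carrier_rel_homology by auto
qed


section \<open>Cohen-Macaulay complexes are pure\<close>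

lemma cohen_macaulay_iff:
  "cohen_macaulay k K \<longleftrightarrow> simplicial_complex K \<and>
     (\<forall>s\<in>K. \<forall>i < complex_dim (link K s). exact_at k i (link K s))"
  by (auto simp: cohen_macaulay_def trivial_reduced_homology_iff simplicial_complex_link)

lemma cohen_macaulay_link:
  assumes "cohen_macaulay k K" "s \<in> K"
  shows "cohen_macaulay k (link K s)"
proof -
  have "link (link K s) r = link K (s \<union> r)" "s \<union> r \<in> K" if "r \<in> link K s" for r
    using that link_link[of s r K] by (auto simp: mem_link Un_commute)
  with assms show ?thesis
    by (auto simp: cohen_macaulay_iff simplicial_complex_link)
qed

text \<open>Adjacent vertices have links of equal dimension, so the set of vertices whose link has top
  dimension is a union of connected components; \<open>exact_at\<close> in degree 0 leaves only one.\<close>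

lemma cohen_macaulay_equidimensional:
  fixes k :: "'k::field itself"
  shows "cohen_macaulay k K \<Longrightarrow> complex_dim K = int n - 1 \<Longrightarrow> equidimensional n K"
proof (induction n arbitrary: K rule: less_induct)
  case (less n)
  have K: "simplicial_complex K"
    using less.prems by (simp add: cohen_macaulay_iff)
  have le: "card s \<le> n" if "s \<in> K" for s
    using card_le_complex_dim[OF K that] less.prems by simp
  \<comment> \<open>The number of vertices in a largest face of the link of \<open>x\<close>. For a
    vertex \<open>x\<close> the link has dimension at least -1, so \<open>nat\<close> truncates
    nothing.\<close>
  define N where "N x = nat (complex_dim (link K {x}) + 1)" for x
  have N: "complex_dim (link K {x}) = int (N x) - 1" if "{x} \<in> K" for x
    using card_le_complex_dim[OF simplicial_complex_link[OF K that], of "{}"]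
      simplicial_complexD(2)[OF simplicial_complex_link[OF K that]] by (simp add: N_def)
  have le_N: "card t \<le> Suc (N x)" if "x \<in> t" "t \<in> K" for x t
  proof -
    have x: "{x} \<in> K" and "t - {x} \<in> link K {x}"
      using that simplicial_complexD(4)[OF K, of t] by (auto simp: mem_link_singleton insert_absorb)
    then have "card (t - {x}) \<le> N x"
      using card_le_complex_dim[OF simplicial_complex_link[OF K x]] N[OF x] by fastforce
    then show ?thesis
      using that simplicial_complexD(3)[OF K] by (simp add: card_Diff_singleton)
  qed
  have N_less: "N x < n" if x: "{x} \<in> K" for x
  proof -
    obtain t where t: "t \<in> link K {x}" "int (card t) = int (N x)"
      using obtain_top_face[OF simplicial_complex_link[OF K x]] N[OF x] by force
    then have "card (insert x t) = Suc (N x)" "insert x t \<in> K"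
      using simplicial_complexD(3)[OF simplicial_complex_link[OF K x]] by (auto simp: mem_link_singleton)
    then show ?thesis
      using le by fastforce
  qed
  have eq_link: "equidimensional (N x) (link K {x})" if "{x} \<in> K" for x
    using less.IH[OF N_less cohen_macaulay_link N] less.prems(1) that by blast
  have ext: "\<exists>t\<in>K. s \<subseteq> t \<and> card t = Suc (N x)" if s: "s \<in> K" "x \<in> s" for s x
  proof -
    have x: "{x} \<in> K" "s - {x} \<in> link K {x}"
      using s simplicial_complexD(4)[OF K, of s] by (auto simp: mem_link_singleton insert_absorb)
    then obtain t where t: "t \<in> link K {x}" "s - {x} \<subseteq> t" "card t = N x"
      using eq_link[OF x(1)] unfolding equidimensional_def by meson
    then have "card (insert x t) = Suc (N x)" "insert x t \<in> K" "s \<subseteq> insert x t"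
      using simplicial_complexD(3)[OF simplicial_complex_link[OF K x(1)]] by (auto simp: mem_link_singleton)
    then show ?thesis
      by blast
  qed
  obtain t0 where t0: "t0 \<in> K" "card t0 = n"
    using obtain_top_face[OF K] less.prems(2) by auto
  \<comment> \<open>Extending the edge within the star of \<open>x\<close> gives a face with
    \<open>Suc (N x)\<close> vertices that also contains \<open>y\<close>. By symmetry
    \<open>N\<close> is constant along edges.\<close>
  have N_edge: "N y \<ge> N x" if "{x, y} \<in> K" for x y
    using ext[OF that, of x] le_N[of y] by fastforce
  have N_eq: "Suc (N w) = n" if w: "{w} \<in> K" for w
  proof (cases "n = 1")
    case True
    then show ?thesis
      using N_less[OF w] by simp
  next
    case False
    then have "n \<ge> 2"
      using N_less[OF w] by simp
    \<comment> \<open>Degree 0 lies below the dimension \<open>n - 1\<close> precisely because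
      \<open>n\<close> is at least 2.\<close>
    then have ex0: "exact_at k 0 K"
      using less.prems simplicial_complexD(2)[OF K] unfolding cohen_macaulay_iff by fastforce
    obtain x where x: "x \<in> t0"
      using t0 \<open>n \<ge> 2\<close> by fastforce
    have xK: "{x} \<in> K"
      using simplicial_complexD(4)[OF K t0(1)] x by auto
    have Nx: "Suc (N x) = n"
      using le_N[OF x t0(1)] N_less[OF xK] t0(2) by simp
    show ?thesis
    proof (rule ccontr)
      assume Nw: "Suc (N w) \<noteq> n"
      \<comment> \<open>The vertex \<open>u\<close> as a 0-chain. In the augmented complex its
        boundary is 1 on the empty face.\<close>
      define \<delta> :: "'a \<Rightarrow> 'a set \<Rightarrow> 'k" where "\<delta> u s = (if s = {u} then 1 else 0)" for u s
      have \<delta>: "boundary (\<delta> u) t = (if t = {} then 1 else 0)" for u t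
      proof -
        have "{v. v \<notin> t \<and> \<delta> u (insert v t) \<noteq> 0} = (if t = {} then {u} else {})"
          by (auto simp: \<delta>_def)
        then show ?thesis
          unfolding boundary_def by (simp add: \<delta>_def)
      qed
      note V = simplicial_complexD(5)[OF K]
      have ch: "is_chain 0 K (\<delta> u)" if "{u} \<in> K" for u
        using that by (auto simp: is_chain_def \<delta>_def)
      have "boundary (\<delta> x - \<delta> w) = boundary (\<delta> x) - boundary (\<delta> w)"
        using ch xK w by (intro boundary_diff[OF V] is_chain_supported_on[OF _ order_refl])
      also have "\<dots> = 0"
        by (simp add: fun_eq_iff \<delta>)
      finally obtain b where b: "is_chain 1 K b" "boundary b = \<delta> x - \<delta> w"
        using exact_atD[OF ex0 is_chain_diff[OF ch[OF xK] ch[OF w]]] by auto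
      \<comment> \<open>\<open>b'\<close> keeps the edges of \<open>b\<close> that meet
        \<open>W\<close>. No edge leaves \<open>W\<close>, so the boundary of \<open>b'\<close> is
        the part of \<open>\<delta> x - \<delta> w\<close> on \<open>W\<close>, which is
        \<open>\<delta> x\<close>. But a single vertex is not a cycle.\<close>
      define W where "W = {u. Suc (N u) = n}"
      define b' where "b' s = (if s \<inter> W = {} then 0 else b s)" for s
      have b': "is_chain 1 K b'"
        using b(1) by (auto simp: is_chain_def b'_def)
      have "boundary b' t = (if t \<inter> W = {} then 0 else boundary b t)" for t
      proof (cases "t \<inter> W = {}")
        case True
        have "b' (insert v t) = 0" if "v \<notin> t" for v
        proof (rule ccontr)
          assume *: "b' (insert v t) \<noteq> 0"
          then have "v \<in> W" "insert v t \<in> K" "card (insert v t) = 2"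
            using True b' by (auto simp: b'_def is_chain_def split: if_splits)
          then have "card t = 1"
            using that simplicial_complexD(3)[OF K] by fastforce
          then obtain u where "t = {u}"
            by (auto simp: card_1_singleton_iff)
          then have "u \<in> W"
            using N_edge[of v u] N_less[of u] \<open>v \<in> W\<close> \<open>insert v t \<in> K\<close>
              simplicial_complexD(4)[OF K \<open>insert v t \<in> K\<close>, of "{u}"] by (auto simp: W_def)
          with True \<open>t = {u}\<close> show False
            by auto
        qed
        with True show ?thesis
          by (auto simp: boundary_def intro!: sum.neutral)
      next
        case False
        then have "b' (insert v t) = b (insert v t)" for v
          by (auto simp: b'_def)
        with False show ?thesis
          by (simp add: boundary_def)
      qed
      then have "boundary b' = \<delta> x"
        using b(2) Nx Nw by (auto simp: fun_eq_iff \<delta>_def W_def)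
      then have "boundary (\<delta> x) = 0"
        using boundary_boundary[OF V is_chain_supported_on[OF b' order_refl]] by simp
      then have "boundary (\<delta> x) {} = 0"
        by simp
      then show False
        by (simp add: \<delta>)
    qed
  qed
  have "\<exists>t\<in>K. s \<subseteq> t \<and> card t = n" if s: "s \<in> K" for s
  proof (cases "s = {}")
    case True
    with t0 show ?thesis
      by auto
  next
    case False
    then obtain x where "x \<in> s"
      by auto
    then show ?thesis
      using ext[OF s] N_eq[of x] simplicial_complexD(4)[OF K s, of "{x}"] by auto
  qed
  with le show ?case
    by (simp add: equidimensional_def)
qed

section \<open>Lifting relative cycles\<close>

text \<open>The lifting condition of \<open>homology_map_cost_surj\<close>, with complex, degree and
  face variable so that an induction can pass to links.\<close>

definition cycles_lift :: "'k::field itself \<Rightarrow> int \<Rightarrow> 'a set set \<Rightarrow> 'a set \<Rightarrow> bool" where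
  "cycles_lift k n K s \<longleftrightarrow>
     (\<forall>c :: 'a set \<Rightarrow> 'k. is_chain n K c \<longrightarrow> (\<forall>t. s \<subseteq> t \<longrightarrow> boundary c t = 0) \<longrightarrow>
        (\<exists>c'. is_chain n K c' \<and> boundary c' = 0 \<and> (\<forall>t. s \<subseteq> t \<longrightarrow> c' t = c t)))"

text \<open>Contract \<open>c\<close> with \<open>x\<close>, lift the result to a cycle
  \<open>a'\<close> of the link, and cone again. The cone has the coefficients of \<open>c\<close>
  above \<open>s\<close> but boundary \<open>a'\<close>. Subtracting a filling of \<open>a'\<close>
  that avoids \<open>x\<close> makes it a cycle and changes nothing above \<open>s\<close>, as
  \<open>x\<close> lies in \<open>s\<close>.\<close>

lemma cycles_lift_vertex:
  fixes k :: "'k::field itself"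
  assumes K: "simplicial_complex K" and x: "{x} \<in> K" "x \<in> s"
    and lk: "cycles_lift k (n - 1) (link K {x}) (s - {x})"
    and fill: "\<And>a :: 'a set \<Rightarrow> 'k. is_chain (n - 1) (link K {x}) a \<Longrightarrow> boundary a = 0 \<Longrightarrow>
      \<exists>e. is_chain n (deletion K x) e \<and> boundary e = a"
  shows "cycles_lift k n K s"
  unfolding cycles_lift_def
proof (intro allI impI)
  fix c :: "'a set \<Rightarrow> 'k"
  assume c: "is_chain n K c" "\<forall>t. s \<subseteq> t \<longrightarrow> boundary c t = 0"
  note V = simplicial_complexD(5)[OF K]
  have xV: "x \<in> \<Union>K"
    using x by auto
  have cV: "supported_on (\<Union>K) c"
    by (rule is_chain_supported_on[OF c(1) order_refl])
  have a: "is_chain (n - 1) (link K {x}) (contract x c)"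
    using is_chain_contract[OF _ K, of "n - 1"] c(1) by simp
  have "boundary (contract x c) t = 0" if "s - {x} \<subseteq> t" for t
  proof -
    have "s \<subseteq> insert x t"
      using that by auto
    then show ?thesis
      using c(2) by (auto simp: boundary_contract[OF V cV] contract_def)
  qed
  then obtain a' where a': "is_chain (n - 1) (link K {x}) a'" "boundary a' = 0"
      "\<And>t. s - {x} \<subseteq> t \<Longrightarrow> a' t = contract x c t"
    using lk a unfolding cycles_lift_def by blast
  obtain e where e: "is_chain n (deletion K x) e" "boundary e = a'"
    using fill[OF a'(1,2)] by blast
  have ch: "is_chain n K (cone x a')"
    using is_chain_cone[OF a'(1) K] by simp
  have eK: "is_chain n K e"
    using is_chain_mono[OF e(1) deletion_subset] .
  have "is_chain (n - 1) K a'"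
    using a'(1) link_subset[OF K] by (rule is_chain_mono)
  then have a'V: "supported_on (\<Union>K) a'"
    by (rule is_chain_supported_on) simp
  have "boundary (cone x a' - e) = boundary (cone x a') - boundary e"
    by (rule boundary_diff[OF V is_chain_supported_on[OF ch order_refl]
          is_chain_supported_on[OF eK order_refl]])
  also have "\<dots> = 0"
    by (simp add: boundary_cone[OF V a'V xV] a'(2) e(2))
  finally have "boundary (cone x a' - e) = 0" .
  moreover have "(cone x a' - e) t = c t" if "s \<subseteq> t" for t
  proof -
    have t: "x \<in> t" "s - {x} \<subseteq> t - {x}"
      using that x by auto
    then have "cone x a' t = cone x (contract x c) t"
      by (simp add: cone_def a'(3))
    moreover have "e t = 0"
      using e(1) t by (auto simp: is_chain_def mem_deletion)
    ultimately show ?thesis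
      using t by (simp add: cone_contract_self)
  qed
  ultimately show "\<exists>c'. is_chain n K c' \<and> boundary c' = 0 \<and> (\<forall>t. s \<subseteq> t \<longrightarrow> c' t = c t)"
    using is_chain_diff[OF ch eK] by blast
qed

text \<open>Induction on \<open>s\<close>, removing a vertex and passing to its link. Each passage
  lowers the degree by one, which accounts for \<open>card r\<close>.\<close>

lemma cycles_lift_of_exact:
  fixes k :: "'k::field itself"
  assumes "finite s"
  shows "simplicial_complex K \<Longrightarrow> s \<in> K \<Longrightarrow>
    (\<And>r v. v \<notin> r \<Longrightarrow> insert v r \<in> K \<Longrightarrow>
      exact_at k (n - 1 - int (card r)) (deletion (link K r) v)) \<Longrightarrow> cycles_lift k n K s"
  using assms
proof (induction s arbitrary: K n)
  case empty
  \<comment> \<open>For the empty face the assumption says that \<open>c\<close> itself is a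
    cycle.\<close>
  show ?case
    unfolding cycles_lift_def by (metis empty_subsetI ext zero_fun_apply)
next
  case (insert x s)
  note K = \<open>simplicial_complex K\<close>
  have x: "{x} \<in> K" "s - {x} = s" "s \<in> link K {x}"
    using simplicial_complexD(4)[OF K insert.prems(2)] insert by (auto simp: mem_link_singleton)
  have "cycles_lift k (n - 1) (link K {x}) s"
  proof (rule insert.IH)
    show "simplicial_complex (link K {x})"
      using simplicial_complex_link[OF K x(1)] .
    fix r v
    assume r: "v \<notin> r" "insert v r \<in> link K {x}"
    then have *: "x \<notin> r" "v \<noteq> x" "insert v (insert x r) \<in> K"
      by (auto simp: mem_link_singleton insert_commute)
    then have "finite r"
      using simplicial_complexD(3)[OF K *(3)] by simp
    then show "exact_at k (n - 1 - 1 - int (card r)) (deletion (link (link K {x}) r) v)"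
      using insert.prems(3)[of v "insert x r"] r * link_link[of "{x}" r K] by (simp add: algebra_simps)
  qed (rule x(3))
  moreover have "\<exists>e. is_chain n (deletion K x) e \<and> boundary e = a"
    if "is_chain (n - 1) (link K {x}) a" "boundary a = 0" for a :: "'a set \<Rightarrow> 'k"
  proof -
    have "exact_at k (n - 1) (deletion K x)"
      using insert.prems(3)[of x "{}"] x by simp
    from exact_atD[OF this is_chain_mono[OF that(1) link_singleton_subset_deletion[OF K]] that(2)]
    show ?thesis
      by auto
  qed
  ultimately show ?case
    using x by (intro cycles_lift_vertex[OF K x(1)]) auto
qed


section \<open>Removing the top layer of a pure complex\<close>

text \<open>Models the order complex of the proper part of \<open>P\<close>, with \<open>M\<close>
  the maximal elements. Here \<open>d\<close> counts the vertices of a facet, so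
  \<open>\<Delta>\<close> has dimension \<open>d - 1\<close>.\<close>

locale top_layer =
  fixes k :: "'k::field itself" and \<Delta> :: "'a set set" and M :: "'a set" and d :: nat
  assumes simplicial: "simplicial_complex \<Delta>"
    and card_le: "s \<in> \<Delta> \<Longrightarrow> card s \<le> d"
    and extend: "s \<in> \<Delta> \<Longrightarrow> \<exists>t\<in>\<Delta>. \<exists>y. s \<subseteq> t \<and> card t = d \<and> t \<inter> M = {y}"
    and doubly_cm: "y \<in> M \<Longrightarrow> {y} \<in> \<Delta> \<Longrightarrow> doubly_cohen_macaulay k (link \<Delta> {y})"
begin

definition lower :: "'a set set" where
  "lower = {s \<in> \<Delta>. s \<inter> M = {}}"

lemma mem_lower: "s \<in> lower \<longleftrightarrow> s \<in> \<Delta> \<and> s \<inter> M = {}"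
  by (simp add: lower_def)

lemma simplicial_lower: "simplicial_complex lower"
proof -
  have "t \<in> lower" if "s \<in> lower" "t \<subseteq> s" for s t
    using that simplicial_complexD(4)[OF simplicial, of s t] by (auto simp: mem_lower)
  moreover have "finite lower"
    using simplicial_complexD(1)[OF simplicial] by (simp add: lower_def)
  moreover have "{} \<in> lower"
    using simplicial_complexD(2)[OF simplicial] by (simp add: mem_lower)
  moreover have "finite s" if "s \<in> lower" for s
    using that simplicial_complexD(3)[OF simplicial] by (simp add: mem_lower)
  ultimately show ?thesis
    unfolding simplicial_complex_def by blast
qed

lemma unique_top: "s \<in> \<Delta> \<Longrightarrow> x \<in> s \<inter> M \<Longrightarrow> y \<in> s \<inter> M \<Longrightarrow> x = y"
proof -
  assume *: "s \<in> \<Delta>" "x \<in> s \<inter> M" "y \<in> s \<inter> M"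
  obtain t z where "s \<subseteq> t" "t \<inter> M = {z}"
    using extend[OF *(1)] by blast
  then have "s \<inter> M \<subseteq> {z}"
    by blast
  with * show "x = y"
    by blast
qed

lemma equidimensional_complex: "equidimensional d \<Delta>"
  unfolding equidimensional_def using card_le extend by meson

lemma d_pos: "d \<ge> 1"
proof -
  obtain t y where t: "t \<in> \<Delta>" "card t = d" "t \<inter> M = {y}"
    using extend[OF simplicial_complexD(2)[OF simplicial]] by blast
  then have "y \<in> t" "finite t"
    using simplicial_complexD(3)[OF simplicial] by blast+
  then have "card t > 0"
    using card_gt_0_iff by blast
  with t show ?thesis
    by simp
qed

text \<open>Extend a face to a facet of \<open>\<Delta>\<close> and drop its only vertex in
  \<open>M\<close>.\<close>

lemma equidimensional_lower: "equidimensional (d - 1) lower"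
proof -
  have "card s \<le> d - 1 \<and> (\<exists>t\<in>lower. s \<subseteq> t \<and> card t = d - 1)" if s: "s \<in> lower" for s
  proof -
    obtain t y where t: "t \<in> \<Delta>" "s \<subseteq> t" "card t = d" "t \<inter> M = {y}"
      using extend[of s] s by (auto simp: mem_lower)
    note fin = simplicial_complexD(3)[OF simplicial t(1)]
    have "y \<in> t"
      using t(4) by blast
    have "t - {y} \<in> lower"
      using t simplicial_complexD(4)[OF simplicial t(1), of "t - {y}"] by (auto simp: mem_lower)
    moreover have "s \<subseteq> t - {y}"
      using s t by (auto simp: mem_lower)
    moreover have "card (t - {y}) = d - 1"
      using t(3) \<open>y \<in> t\<close> by (simp add: card_Diff_singleton)
    ultimately show ?thesis
      using card_mono[of "t - {y}" s] fin by auto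
  qed
  then show ?thesis
    by (simp add: equidimensional_def)
qed

section \<open>Dimensions and exactness in the links of top vertices\<close>

lemma complex_dim_link_complex:
  "s \<in> \<Delta> \<Longrightarrow> complex_dim (link \<Delta> s) = int d - int (card s) - 1"
  using complex_dim_link[OF simplicial equidimensional_complex] .

lemma complex_dim_link_lower:
  "s \<in> lower \<Longrightarrow> complex_dim (link lower s) = int d - int (card s) - 2"
  using complex_dim_link[OF simplicial_lower equidimensional_lower] d_pos by (simp add: of_nat_diff)

lemma complex_dim_lower: "complex_dim lower = int d - 2"
  using complex_dim_link_lower[OF simplicial_complexD(2)[OF simplicial_lower]] by simp

lemma exact_link_top:
  assumes s: "insert y s \<in> \<Delta>" "y \<in> M" "y \<notin> s" and i: "i < int d - int (card s) - 2"
  shows "exact_at k i (link (link \<Delta> {y}) s)"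
proof -
  have y: "{y} \<in> \<Delta>" "s \<in> link \<Delta> {y}"
    using s simplicial_complexD(4)[OF simplicial s(1)] by (auto simp: mem_link_singleton)
  have "complex_dim (link (link \<Delta> {y}) s) = int (d - 1) - int (card s) - 1"
    using complex_dim_link[OF simplicial_complex_link[OF simplicial y(1)]
        equidimensional_link[OF simplicial equidimensional_complex y(1)] y(2)] by simp
  then show ?thesis
    using doubly_cm[OF s(2) y(1)] y i d_pos
    by (auto simp: doubly_cohen_macaulay_def cohen_macaulay_iff of_nat_diff)
qed

text \<open>Purity of the deletion comes from Cohen-Macaulayness; it yields the dimensions of the
  links inside the deletion, and thus the range of degrees where they are exact.\<close>

lemma deletion_top:
  assumes x: "{x, y} \<in> \<Delta>" "y \<in> M" "x \<noteq> y"
  shows "cohen_macaulay k (deletion (link \<Delta> {y}) x)"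
    and "equidimensional (d - 1) (deletion (link \<Delta> {y}) x)"
proof -
  have y: "{y} \<in> \<Delta>" "{x} \<in> link \<Delta> {y}"
    using x simplicial_complexD(4)[OF simplicial x(1)] by (auto simp: mem_link_singleton insert_commute)
  show cm: "cohen_macaulay k (deletion (link \<Delta> {y}) x)"
    using doubly_cm[OF x(2) y(1)] y(2) by (simp add: doubly_cohen_macaulay_def)
  have "complex_dim (deletion (link \<Delta> {y}) x) = complex_dim (link \<Delta> {y})"
    using doubly_cm[OF x(2) y(1)] y(2) by (simp add: doubly_cohen_macaulay_def)
  also have "\<dots> = int (d - 1) - 1"
    using complex_dim_link_complex[OF y(1)] d_pos by (simp add: of_nat_diff)
  finally show "equidimensional (d - 1) (deletion (link \<Delta> {y}) x)"
    using cohen_macaulay_equidimensional[OF cm] by blast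
qed

lemma exact_link_deletion_top:
  assumes s: "insert x (insert y s) \<in> \<Delta>" "y \<in> M" "x \<noteq> y" "x \<notin> s" "y \<notin> s"
    and i: "i < int d - int (card s) - 2"
  shows "exact_at k i (link (deletion (link \<Delta> {y}) x) s)"
proof -
  have xy: "{x, y} \<in> \<Delta>" "s \<in> deletion (link \<Delta> {y}) x"
    using s simplicial_complexD(4)[OF simplicial s(1)] by (auto simp: mem_link_singleton mem_deletion)
  note cm = deletion_top[OF xy(1) s(2,3)]
  have "complex_dim (link (deletion (link \<Delta> {y}) x) s) = int d - int (card s) - 2"
    using complex_dim_link[OF _ cm(2) xy(2)] cm(1) d_pos by (simp add: cohen_macaulay_iff of_nat_diff)
  then show ?thesis
    using cm(1) xy(2) i by (simp add: cohen_macaulay_iff)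
qed

text \<open>The zero chain is split off because exactness of \<open>L\<close> will only be known
  when \<open>y\<close> is joined to the face \<open>s\<close> under consideration; otherwise the
  link carries no nonzero chain.\<close>

lemma fill_chain:
  fixes a :: "'a set \<Rightarrow> 'k"
  assumes a: "is_chain i K a" "boundary a = 0" and zero: "a \<noteq> 0 \<Longrightarrow> exact_at k i L"
    and K: "K \<subseteq> L" "L \<subseteq> N"
  shows "\<exists>e. is_chain (i + 1) N e \<and> boundary e = a"
proof (cases "a = 0")
  case True
  then show ?thesis
    using boundary_zero is_chain_zero by blast
next
  case False
  obtain e where "is_chain (i + 1) L e" "boundary e = a"
    using exact_atD[OF zero[OF False] is_chain_mono[OF a(1) K(1)] a(2)] .
  then show ?thesis
    using is_chain_mono[OF _ K(2)] by blast
qed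

text \<open>A cycle is filled in \<open>link \<Delta> s\<close> and the parts at top vertices are
  refilled. The bound on \<open>i\<close> is the dimension of \<open>link lower s\<close>, which
  agrees with that of the link of \<open>s\<close> in the link of any \<open>y\<close> in
  \<open>M\<close> joined to \<open>s\<close>.\<close>

lemma exact_link_lower:
  assumes s: "s \<in> lower" and ex: "exact_at k i (link \<Delta> s)" and i: "i < int d - int (card s) - 2"
  shows "exact_at k i (link lower s)"
  unfolding exact_at_def
proof (intro allI impI)
  fix c :: "'a set \<Rightarrow> 'k"
  assume c: "is_chain i (link lower s) c" "boundary c = 0"
  have s\<Delta>: "s \<in> \<Delta>" "s \<inter> M = {}"
    using s by (auto simp: mem_lower)
  have sub: "link lower s \<subseteq> link \<Delta> s"
    by (auto simp: mem_link mem_lower)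
  obtain b where b: "is_chain (i + 1) (link \<Delta> s) b" "boundary b = c"
    using exact_atD[OF ex is_chain_mono[OF c(1) sub] c(2)] .
  have "\<exists>h. is_chain (i + 1) (link lower s) h \<and> boundary h = boundary b"
  proof (rule boundary_remove_vertices[where K = "link \<Delta> s" and M = M])
    show "simplicial_complex (link \<Delta> s)"
      using simplicial_complex_link[OF simplicial s\<Delta>(1)] .
    show "finite (\<Union>(link lower s))"
      using simplicial_complexD(5)[OF simplicial_complex_link[OF simplicial_lower s]] .
    show "x = y" if "t \<in> link \<Delta> s" "x \<in> t \<inter> M" "y \<in> t \<inter> M" for t x y
      using that unique_top[of "t \<union> s" x y] by (auto simp: mem_link)
    show "t \<inter> M = {}" if "boundary b t \<noteq> 0" for t
      using that c(1) b(2) by (auto simp: is_chain_def mem_link mem_lower)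
    show "\<exists>e. is_chain (i + 1) (link lower s) e \<and> boundary e = a"
      if y: "y \<in> M" and a: "is_chain i (link (link \<Delta> s) {y}) a" "boundary a = 0"
      for y and a :: "'a set \<Rightarrow> 'k"
    proof (rule fill_chain[OF a])
      have "y \<notin> s"
        using y s\<Delta> by auto
      show "exact_at k i (link (link \<Delta> {y}) s)" if nz: "a \<noteq> 0"
      proof (rule exact_link_top[OF _ y \<open>y \<notin> s\<close> i])
        obtain t where "a t \<noteq> 0"
          using nz unfolding fun_eq_iff zero_fun_apply by blast
        then have "insert y t \<union> s \<in> \<Delta>"
          using a(1) by (auto simp: is_chain_def mem_link)
        then show "insert y s \<in> \<Delta>"
          by (rule simplicial_complexD(4)[OF simplicial]) auto
      qed
      show "link (link \<Delta> s) {y} \<subseteq> link (link \<Delta> {y}) s"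
        by (auto simp: mem_link)
      \<comment> \<open>A face together with \<open>y\<close> already has its only vertex in
        \<open>M\<close>.\<close>
      show "link (link \<Delta> {y}) s \<subseteq> link lower s"
      proof
        fix t
        assume "t \<in> link (link \<Delta> {y}) s"
        then have t: "t \<inter> s = {}" "y \<notin> t \<union> s" "insert y (t \<union> s) \<in> \<Delta>"
          by (auto simp: mem_link)
        have "u \<notin> M" if "u \<in> t \<union> s" for u
          using that unique_top[OF t(3), of y u] y t(2) by auto
        then have "(t \<union> s) \<inter> M = {}"
          by blast
        moreover have "t \<union> s \<in> \<Delta>"
          by (intro simplicial_complexD(4)[OF simplicial t(3)]) auto
        ultimately show "t \<in> link lower s"
          using t by (simp add: mem_link mem_lower)
      qed
    qed
    show "{t \<in> link \<Delta> s. t \<inter> M = {}} \<subseteq> link lower s"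
      using s\<Delta> by (auto simp: mem_link mem_lower)
  qed (rule b(1))
  with b(2) show "\<exists>b. is_chain (i + 1) (link lower s) b \<and> boundary b = c"
    by simp
qed

text \<open>The first filling takes place in the link of \<open>insert x s\<close> and so avoids
  \<open>x\<close>; the refillings avoid \<open>x\<close> by exactness of the deletions. The bound
  on \<open>i\<close> admits the top degree of \<open>link lower (insert x s)\<close>, where its own
  exactness may fail.\<close>

lemma cycle_link_bounds_in_deletion:
  fixes a :: "'a set \<Rightarrow> 'k"
  assumes xs: "x \<notin> s" "insert x s \<in> lower" and ex: "exact_at k i (link \<Delta> (insert x s))"
    and i: "i < int d - int (card s) - 2"
    and a: "is_chain i (link lower (insert x s)) a" "boundary a = 0"
  shows "\<exists>e. is_chain (i + 1) (deletion (link lower s) x) e \<and> boundary e = a"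
proof -
  let ?K = "link \<Delta> (insert x s)" and ?N = "deletion (link lower s) x"
  have xs\<Delta>: "insert x s \<in> \<Delta>" "insert x s \<inter> M = {}"
    using xs by (auto simp: mem_lower)
  have s: "s \<in> lower"
    using simplicial_complexD(4)[OF simplicial_lower xs(2)] by blast
  have "link lower (insert x s) \<subseteq> ?K"
    by (auto simp: mem_link mem_lower)
  then obtain b where b: "is_chain (i + 1) ?K b" "boundary b = a"
    using exact_atD[OF ex is_chain_mono[OF a(1)] a(2)] by blast
  have K: "simplicial_complex ?K"
    using simplicial_complex_link[OF simplicial xs\<Delta>(1)] .
  have "\<exists>h. is_chain (i + 1) ?N h \<and> boundary h = boundary b"
  proof (rule boundary_remove_vertices[where K = ?K and M = M])
    show "simplicial_complex ?K"
      by (rule K)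
    show "finite (\<Union>?N)"
      using simplicial_complexD(5)[OF simplicial_complex_deletion[OF
            simplicial_complex_link[OF simplicial_lower s]]] .
    show "u = v" if "t \<in> ?K" "u \<in> t \<inter> M" "v \<in> t \<inter> M" for t u v
      using that unique_top[of "t \<union> insert x s" u v] by (auto simp: mem_link)
    show "t \<inter> M = {}" if "boundary b t \<noteq> 0" for t
      using that a(1) b(2) by (auto simp: is_chain_def mem_link mem_lower)
    show "\<exists>e. is_chain (i + 1) ?N e \<and> boundary e = c"
      if y: "y \<in> M" and c: "is_chain i (link ?K {y}) c" "boundary c = 0"
      for y and c :: "'a set \<Rightarrow> 'k"
    proof (rule fill_chain[OF c])
      have y': "y \<notin> s" "x \<noteq> y"
        using y xs\<Delta> by auto
      show "exact_at k i (link (deletion (link \<Delta> {y}) x) s)" if nz: "c \<noteq> 0"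
      proof (rule exact_link_deletion_top[OF _ y y'(2) xs(1) y'(1) i])
        obtain t where "c t \<noteq> 0"
          using nz unfolding fun_eq_iff zero_fun_apply by blast
        then have "insert y t \<union> insert x s \<in> \<Delta>"
          using c(1) by (auto simp: is_chain_def mem_link)
        then show "insert x (insert y s) \<in> \<Delta>"
          by (rule simplicial_complexD(4)[OF simplicial]) auto
      qed
      show "link ?K {y} \<subseteq> link (deletion (link \<Delta> {y}) x) s"
      proof
        fix t
        assume "t \<in> link ?K {y}"
        then have t: "y \<notin> t" "t \<inter> insert x s = {}" "insert y t \<union> insert x s \<in> \<Delta>"
          by (auto simp: mem_link)
        then have "insert y (t \<union> s) \<in> \<Delta>"
          by (intro simplicial_complexD(4)[OF simplicial t(3)]) auto
        with t y' xs(1) show "t \<in> link (deletion (link \<Delta> {y}) x) s"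
          by (auto simp: mem_link mem_deletion)
      qed
      show "link (deletion (link \<Delta> {y}) x) s \<subseteq> ?N"
      proof
        fix t
        assume "t \<in> link (deletion (link \<Delta> {y}) x) s"
        then have t: "t \<inter> s = {}" "y \<notin> t \<union> s" "x \<notin> t" "insert y (t \<union> s) \<in> \<Delta>"
          by (auto simp: mem_link mem_deletion)
        have "u \<notin> M" if "u \<in> t \<union> s" for u
          using that unique_top[OF t(4), of y u] y t(2) by auto
        then have "(t \<union> s) \<inter> M = {}"
          by blast
        moreover have "t \<union> s \<in> \<Delta>"
          by (intro simplicial_complexD(4)[OF simplicial t(4)]) auto
        ultimately show "t \<in> ?N"
          using t by (simp add: mem_link mem_lower mem_deletion)
      qed
    qed
    show "{t \<in> ?K. t \<inter> M = {}} \<subseteq> ?N"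
    proof
      fix t
      assume "t \<in> {t \<in> ?K. t \<inter> M = {}}"
      then have t: "t \<inter> insert x s = {}" "t \<union> insert x s \<in> \<Delta>" "t \<inter> M = {}"
        by (auto simp: mem_link)
      then have "t \<union> s \<in> \<Delta>"
        by (intro simplicial_complexD(4)[OF simplicial t(2)]) auto
      with t xs\<Delta> show "t \<in> ?N"
        by (auto simp: mem_link mem_lower mem_deletion)
    qed
  qed (rule b(1))
  with b(2) show ?thesis
    by simp
qed

text \<open>Combines both claims through \<open>exact_at_deletion\<close>. If \<open>v\<close> is
  not joined to \<open>s\<close>, its link contains no faces at all and only the zero chain has to
  be filled.\<close>

lemma exact_deletion_link_lower:
  assumes s: "s \<in> lower" "v \<notin> s" and i: "i < int d - int (card s) - 2"
    and ex: "exact_at k i (link \<Delta> s)"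
    and ex': "insert v s \<in> lower \<Longrightarrow> exact_at k i (link \<Delta> (insert v s))"
  shows "exact_at k i (deletion (link lower s) v)"
proof (rule exact_at_deletion)
  show "simplicial_complex (link lower s)"
    using simplicial_complex_link[OF simplicial_lower s(1)] .
  show "exact_at k i (link lower s)"
    using exact_link_lower[OF s(1) ex i] .
  fix a :: "'a set \<Rightarrow> 'k"
  assume a: "is_chain i (link (link lower s) {v}) a" "boundary a = 0"
  have lk: "link (link lower s) {v} = link lower (insert v s)"
    using link_link[of s "{v}" lower] s(2) by simp
  show "\<exists>e. is_chain (i + 1) (deletion (link lower s) v) e \<and> boundary e = a"
  proof (cases "insert v s \<in> lower")
    case True
    show ?thesis
      using cycle_link_bounds_in_deletion[OF s(2) True ex'[OF True] i a(1)[unfolded lk] a(2)] .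
  next
    case False
    then have "a = 0"
      using a(1) simplicial_complexD(4)[OF simplicial_lower, of _ "insert v s"]
      unfolding lk is_chain_def by (auto simp: mem_link fun_eq_iff)
    then show ?thesis
      using boundary_zero is_chain_zero by blast
  qed
qed

lemma doubly_cohen_macaulay_lower:
  assumes ex: "\<And>s i. s \<in> \<Delta> \<Longrightarrow> i < int d - int (card s) - 1 \<Longrightarrow> exact_at k i (link \<Delta> s)"
  shows "doubly_cohen_macaulay k lower"
  unfolding doubly_cohen_macaulay_def
proof (intro conjI allI impI)
  show "cohen_macaulay k lower"
    using ex exact_link_lower simplicial_lower
    by (auto simp: cohen_macaulay_iff complex_dim_link_lower mem_lower)
  fix v
  assume v: "{v} \<in> lower"
  note del = simplicial_complex_deletion[OF simplicial_lower, of v]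
  show "cohen_macaulay k (deletion lower v)"
    unfolding cohen_macaulay_iff
  proof (intro conjI ballI allI impI)
    fix s i
    assume s: "s \<in> deletion lower v" and i: "i < complex_dim (link (deletion lower v) s)"
    then have s': "s \<in> lower" "v \<notin> s" "s \<in> \<Delta>"
      by (auto simp: mem_deletion mem_lower)
    have eq: "link (deletion lower v) s = deletion (link lower s) v"
      by (rule link_deletion[OF s'(2)])
    \<comment> \<open>Deleting \<open>v\<close> cannot raise the dimension of the link, so
      \<open>i\<close> is below the dimension of \<open>link lower s\<close> as well.\<close>
    obtain t where "t \<in> link (deletion lower v) s"
        "int (card t) = complex_dim (link (deletion lower v) s) + 1"
      using obtain_top_face[OF simplicial_complex_link[OF del s]] .
    then have "complex_dim (link (deletion lower v) s) \<le> int d - int (card s) - 2"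
      using card_le_complex_dim[OF simplicial_complex_link[OF simplicial_lower s'(1)], of t]
        complex_dim_link_lower[OF s'(1)] by (auto simp: eq mem_deletion)
    then have i': "i < int d - int (card s) - 2"
      using i by simp
    have "card (insert v s) = Suc (card s)" if "insert v s \<in> lower"
      using s'(2) simplicial_complexD(3)[OF simplicial s'(3)] by simp
    then show "exact_at k i (link (deletion lower v) s)"
      unfolding eq using s' i'
      by (intro exact_deletion_link_lower ex) (auto simp: mem_lower)
  qed (rule del)
  show "complex_dim (deletion lower v) = complex_dim lower"
  proof -
    \<comment> \<open>A face of full size avoiding \<open>v\<close> is found in the link of a top
      vertex \<open>y\<close> adjacent to \<open>v\<close>: deleting \<open>v\<close> there
      preserves the dimension \<open>d - 2\<close>.\<close>
    obtain t y where t: "t \<in> \<Delta>" "{v} \<subseteq> t" "t \<inter> M = {y}"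
      using extend[of "{v}"] v by (auto simp: mem_lower)
    have vy: "{v, y} \<in> \<Delta>" "y \<in> M" "v \<noteq> y"
      using t v simplicial_complexD(4)[OF simplicial t(1), of "{v, y}"] by (auto simp: mem_lower)
    note top = deletion_top[OF vy]
    obtain u where u: "u \<in> deletion (link \<Delta> {y}) v" "card u = d - 1"
      using top simplicial_complexD(2) unfolding equidimensional_def cohen_macaulay_iff by metis
    then have u': "v \<notin> u" "y \<notin> u" "insert y u \<in> \<Delta>"
      by (auto simp: mem_deletion mem_link)
    have "w \<notin> M" if "w \<in> u" for w
      using that unique_top[OF u'(3), of y w] vy(2) u'(2) by auto
    then have "u \<inter> M = {}"
      by blast
    moreover have "u \<in> \<Delta>"
      by (intro simplicial_complexD(4)[OF simplicial u'(3)]) auto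
    ultimately have "u \<in> deletion lower v"
      using u' by (simp add: mem_deletion mem_lower)
    moreover have "card s \<le> d - 1" if "s \<in> deletion lower v" for s
      using that equidimensional_lower by (simp add: mem_deletion equidimensional_def)
    ultimately have "complex_dim (deletion lower v) = int (d - 1) - 1"
      using complex_dim_eqI[OF simplicial_complexD(1)[OF del]] u(2) by blast
    then show ?thesis
      using d_pos by (simp add: complex_dim_lower of_nat_diff)
  qed
qed

text \<open>Nothing is assumed about the link of the empty face, so \<open>deletion lower x\<close>
  need not be exact. The first vertex \<open>x\<close> of \<open>s\<close> is therefore handled by
  \<open>cycle_link_bounds_in_deletion\<close>; the remaining vertices involve only links of
  nonempty faces.\<close>

lemma buchsbaum_star_lower:
  assumes ex: "\<And>s i. s \<in> \<Delta> \<Longrightarrow> s \<noteq> {} \<Longrightarrow> i < int d - int (card s) - 1 \<Longrightarrow> exact_at k i (link \<Delta> s)"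
  shows "buchsbaum_star k lower"
  unfolding buchsbaum_star_def
proof (intro conjI ballI impI)
  have "pure_complex lower"
    using pure_complex_iff_equidimensional[OF simplicial_lower] equidimensional_lower by blast
  moreover have "trivial_group (reduced_homology k i (link lower s))"
    if "s \<in> lower" "s \<noteq> {}" "i < complex_dim (link lower s)" for s i
    using that exact_link_lower[OF that(1) ex]
    by (simp add: trivial_reduced_homology_iff simplicial_complex_link simplicial_lower
        complex_dim_link_lower mem_lower)
  ultimately show "buchsbaum k lower"
    using simplicial_lower by (simp add: buchsbaum_def)
  fix s
  assume s: "s \<in> lower" "s \<noteq> {}"
  then obtain x where x: "x \<in> s" "{x} \<in> lower"
    using simplicial_complexD(4)[OF simplicial_lower s(1)] by blast
  have "cycles_lift k (int d - 3) (link lower {x}) (s - {x})"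
  proof (rule cycles_lift_of_exact)
    show "finite (s - {x})"
      using simplicial_complexD(3)[OF simplicial_lower s(1)] by simp
    show "simplicial_complex (link lower {x})"
      by (rule simplicial_complex_link[OF simplicial_lower x(2)])
    show "s - {x} \<in> link lower {x}"
      using s x by (auto simp: mem_link_singleton insert_absorb)
    fix r v
    assume r: "v \<notin> r" "insert v r \<in> link lower {x}"
    then have r': "x \<notin> r" "v \<noteq> x" "insert v (insert x r) \<in> lower"
      by (auto simp: mem_link_singleton insert_commute)
    then have xr: "insert x r \<in> lower" "finite r"
      using simplicial_complexD(3,4)[OF simplicial_lower r'(3)] by auto
    \<comment> \<open>One below the dimension \<open>d - 3 - card r\<close> of the link of
      \<open>insert x r\<close>.\<close>
    have "exact_at k (int d - 4 - int (card r)) (deletion (link lower (insert x r)) v)"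
      using r r' xr by (intro exact_deletion_link_lower ex) (auto simp: mem_lower)
    then show "exact_at k (int d - 3 - 1 - int (card r)) (deletion (link (link lower {x}) r) v)"
      using link_link[of "{x}" r lower] r'(1) by simp
  qed
  moreover have "\<exists>e. is_chain (int d - 2) (deletion lower x) e \<and> boundary e = a"
    if "is_chain (int d - 3) (link lower {x}) a" "boundary a = 0" for a :: "'a set \<Rightarrow> 'k"
    using cycle_link_bounds_in_deletion[of x "{}" "int d - 3" a] that ex[of "{x}" "int d - 3"] x(2)
    by (simp add: mem_lower)
  ultimately have "cycles_lift k (int d - 2) lower s"
    using cycles_lift_vertex[OF simplicial_lower x(2,1), of k "int d - 2"] by simp
  then show "homology_map k (complex_dim lower) lower (cost lower s) `
      carrier (reduced_homology k (complex_dim lower) lower) =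
      carrier (rel_homology k (complex_dim lower) lower (cost lower s))"
    unfolding complex_dim_lower cycles_lift_def
    by (intro homology_map_cost_surj[OF simplicial_lower]) blast
qed

end

section \<open>Graded posets with a minimum\<close>

lemma mem_order_complex: "C \<in> order_complex P \<longleftrightarrow> C \<subseteq> P \<and> (\<forall>x\<in>C. \<forall>y\<in>C. x \<le> y \<or> y \<le> x)"
  by (simp add: order_complex_def chain_def)

locale graded_with_bottom =
  fixes P :: "'a::order set" and d :: nat and z :: 'a
  assumes graded: "graded_poset P d" and d: "d \<ge> 2" and z: "z \<in> P" and least: "x \<in> P \<Longrightarrow> z \<le> x"
begin

lemma finite_P: "finite P"
  using graded by (simp add: graded_poset_def)

lemma equidimensional_P: "equidimensional (d + 1) (order_complex P)"
  using graded pure_complex_iff_equidimensional[OF simplicial_complex_order_complex[OF finite_P], of "d + 1"]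
  by (simp add: graded_poset_def)

lemma insert_bottom_iff:
  "z \<notin> s \<Longrightarrow> insert z s \<in> order_complex P \<longleftrightarrow> s \<in> order_complex (P - {z})"
  using z least by (auto simp: mem_order_complex)

lemma bottom_notin: "s \<in> order_complex (P - {z}) \<Longrightarrow> z \<notin> s \<and> finite s"
  using finite_P by (auto simp: mem_order_complex intro: finite_subset)

lemma card_proper_part: "s \<in> order_complex (P - {z}) \<Longrightarrow> card s \<le> d"
  using bottom_notin[of s] insert_bottom_iff[of s] equidimensional_P
  by (fastforce simp: equidimensional_def)

text \<open>Add the minimum and extend to a chain with \<open>d + 1\<close> elements. Its largest
  element is maximal in \<open>P\<close>, since otherwise a longer chain would exist. It is the only
  maximal one, as distinct maximal elements are incomparable, and it is not \<open>z\<close> because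
  the chain has other elements.\<close>

lemma extend_proper_part:
  assumes "s \<in> order_complex (P - {z})"
  shows "\<exists>t\<in>order_complex (P - {z}). \<exists>y. s \<subseteq> t \<and> card t = d \<and> t \<inter> maximal_elements P = {y}"
proof -
  have "insert z s \<in> order_complex P"
    using assms bottom_notin insert_bottom_iff by blast
  then obtain D where D: "D \<in> order_complex P" "insert z s \<subseteq> D" "card D = d + 1"
    using equidimensional_P unfolding equidimensional_def by meson
  have D': "D \<subseteq> P" "\<And>u v. u \<in> D \<Longrightarrow> v \<in> D \<Longrightarrow> u \<le> v \<or> v \<le> u"
    using D(1) by (auto simp: mem_order_complex)
  have fin: "finite D"
    using D'(1) finite_P by (rule finite_subset)
  obtain y where y: "y \<in> D" "\<And>u. u \<in> D \<Longrightarrow> u \<le> y"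
    using finite_has_maximal[OF fin] D(2) D'(2) by (metis empty_iff insert_subset)
  have y_max: "y \<in> maximal_elements P"
    unfolding maximal_elements_def
  proof (intro CollectI conjI ballI impI)
    show "y \<in> P"
      using y D' by blast
    fix x assume x: "x \<in> P" "y \<le> x"
    have "x \<in> D"
    proof (rule ccontr)
      assume "x \<notin> D"
      moreover have "u \<le> x" if "u \<in> D" for u
        using order_trans[OF y(2)[OF that] x(2)] .
      then have "insert x D \<in> order_complex P"
        using x(1) D' by (auto simp: mem_order_complex)
      then have "card (insert x D) \<le> d + 1"
        using equidimensional_P by (simp add: equidimensional_def)
      ultimately show False
        using fin D(3) by simp
    qed
    then show "x = y"
      using y(2) x(2) by (simp add: order_antisym)
  qed
  have "card (D - {z}) = d"
    using D(2,3) by (simp add: card_Diff_singleton)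
  then have "D - {z} \<noteq> {}"
    using d by (metis card.empty not_numeral_le_zero)
  then obtain w where w: "w \<in> D" "w \<noteq> z"
    by blast
  have "y \<noteq> z"
    using y(2)[OF w(1)] w least[of w] D'(1) by (auto intro: order_antisym)
  have "(D - {z}) \<inter> maximal_elements P = {y}"
    using y y_max \<open>y \<noteq> z\<close> D'(1) by (auto simp: maximal_elements_def)
  moreover have "D - {z} \<in> order_complex (P - {z})"
    using D' by (auto simp: mem_order_complex)
  moreover have "s \<subseteq> D - {z}"
    using D(2) assms bottom_notin by blast
  ultimately show ?thesis
    using \<open>card (D - {z}) = d\<close> by blast
qed

lemma link_maximal_element:
  assumes "y \<in> maximal_elements P" "{y} \<in> order_complex (P - {z})"
  shows "link (order_complex (P - {z})) {y} = order_complex (open_interval P z y)"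
proof (intro Set.set_eqI iffI)
  have y: "y \<in> P" "y \<noteq> z" "\<And>x. x \<in> P \<Longrightarrow> y \<le> x \<Longrightarrow> x = y"
    using assms by (auto simp: maximal_elements_def mem_order_complex)
  fix u
  {
    assume "u \<in> link (order_complex (P - {z})) {y}"
    then have u: "y \<notin> u" "u \<subseteq> P - {z}" "\<And>v w. v \<in> insert y u \<Longrightarrow> w \<in> insert y u \<Longrightarrow> v \<le> w \<or> w \<le> v"
      by (auto simp: mem_link_singleton mem_order_complex)
    have "w \<in> open_interval P z y" if "w \<in> u" for w
    proof -
      have w: "w \<in> P" "w \<noteq> z" "w \<noteq> y"
        using that u by auto
      then have "w \<le> y"
        using u(3)[of w y] that y(3)[of w] by auto
      then show ?thesis
        using w least[of w] by (auto simp: open_interval_def)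
    qed
    then show "u \<in> order_complex (open_interval P z y)"
      using u by (auto simp: mem_order_complex)
  next
    assume "u \<in> order_complex (open_interval P z y)"
    then show "u \<in> link (order_complex (P - {z})) {y}"
      using y(1,2) by (auto simp: mem_link_singleton mem_order_complex open_interval_def less_imp_le)
  }
qed

text \<open>The minimum is comparable to everything. So Cohen-Macaulayness of \<open>P\<close>
  reaches all links of the proper part, including that of the empty face.\<close>

lemma link_proper_part:
  assumes "s \<in> order_complex (P - {z})"
  shows "link (order_complex (P - {z})) s = link (order_complex P) (insert z s)"
proof (rule Set.set_eqI)
  fix t
  show "t \<in> link (order_complex (P - {z})) s \<longleftrightarrow> t \<in> link (order_complex P) (insert z s)"
  proof (cases "z \<in> t")
    case True
    then show ?thesis
      using bottom_notin[of "t \<union> s"] by (auto simp: mem_link)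
  next
    case False
    then show ?thesis
      using insert_bottom_iff[of "t \<union> s"] bottom_notin[OF assms] by (simp add: mem_link)
  qed
qed

lemma top_layer_proper_part:
  fixes k :: "'k::field itself"
  assumes "\<forall>y\<in>maximal_elements P. poset_doubly_cohen_macaulay k (open_interval P z y)"
  shows "top_layer k (order_complex (P - {z})) (maximal_elements P) d"
proof
  show "simplicial_complex (order_complex (P - {z}))"
    using finite_P by (intro simplicial_complex_order_complex) simp
  show "\<exists>t\<in>order_complex (P - {z}). \<exists>y. s \<subseteq> t \<and> card t = d \<and> t \<inter> maximal_elements P = {y}"
    if "s \<in> order_complex (P - {z})" for s
    using that by (rule extend_proper_part)
qed (use assms in \<open>simp_all add: card_proper_part link_maximal_element
  poset_doubly_cohen_macaulay_def\<close>)

lemma order_complex_below_top: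
  "order_complex (P - maximal_elements P - {z}) =
     {s \<in> order_complex (P - {z}). s \<inter> maximal_elements P = {}}"
  by (rule Set.set_eqI, simp add: mem_order_complex, blast)

end

theorem theorem3p3:
  fixes P Q :: "'a::order set" and z :: 'a and d :: nat
  assumes "graded_poset P d" and "d \<ge> 2"
    and "z \<in> P" and "\<forall>x\<in>P. z \<le> x"
    and "Q = P - maximal_elements P"
  shows "(poset_cohen_macaulay TYPE('k::field) P \<and>
        (\<forall>y\<in>maximal_elements P. poset_doubly_cohen_macaulay TYPE('k) (open_interval P z y))
        \<longrightarrow> poset_doubly_cohen_macaulay TYPE('k) (Q - {z})) \<and>
      (poset_buchsbaum TYPE('k) (P - {z}) \<and>
        (\<forall>y\<in>maximal_elements P. poset_doubly_cohen_macaulay TYPE('k) (open_interval P z y))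
        \<longrightarrow> poset_buchsbaum_star TYPE('k) (Q - {z}))"
proof -
  interpret graded_with_bottom P d z
    using assms by unfold_locales auto
  let ?\<Delta> = "order_complex (P - {z})" and ?k = "TYPE('k)"
  have "poset_doubly_cohen_macaulay ?k (Q - {z})"
    if cm: "poset_cohen_macaulay ?k P"
      and dcm: "\<forall>y\<in>maximal_elements P. poset_doubly_cohen_macaulay ?k (open_interval P z y)"
  proof -
    interpret top_layer ?k ?\<Delta> "maximal_elements P" d
      by (rule top_layer_proper_part[OF dcm])
    have "exact_at ?k i (link ?\<Delta> s)" if s: "s \<in> ?\<Delta>" and i: "i < int d - int (card s) - 1" for s i
    proof -
      have zs: "insert z s \<in> order_complex P" "card (insert z s) = Suc (card s)"
        using s bottom_notin[OF s] insert_bottom_iff by auto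
      \<comment> \<open>The extra vertex \<open>z\<close> compensates for facets of \<open>P\<close>
        having \<open>d + 1\<close> vertices.\<close>
      have "complex_dim (link (order_complex P) (insert z s)) = int d - int (card s) - 1"
        using complex_dim_link[OF simplicial_complex_order_complex[OF finite_P] equidimensional_P zs(1)]
          zs(2) by simp
      then show ?thesis
        using cm zs(1) i
        by (simp add: poset_cohen_macaulay_def cohen_macaulay_iff link_proper_part[OF s])
    qed
    then show ?thesis
      using doubly_cohen_macaulay_lower assms(5)
      by (simp add: poset_doubly_cohen_macaulay_def order_complex_below_top lower_def)
  qed
  moreover have "poset_buchsbaum_star ?k (Q - {z})"
    if bb: "poset_buchsbaum ?k (P - {z})"
      and dcm: "\<forall>y\<in>maximal_elements P. poset_doubly_cohen_macaulay ?k (open_interval P z y)"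
  proof -
    interpret top_layer ?k ?\<Delta> "maximal_elements P" d
      by (rule top_layer_proper_part[OF dcm])
    have "exact_at ?k i (link ?\<Delta> s)"
      if s: "s \<in> ?\<Delta>" "s \<noteq> {}" and i: "i < int d - int (card s) - 1" for s i
      using bb s i
      by (simp add: poset_buchsbaum_def buchsbaum_def complex_dim_link_complex
          trivial_reduced_homology_iff simplicial_complex_link simplicial)
    then show ?thesis
      using buchsbaum_star_lower assms(5)
      by (simp add: poset_buchsbaum_star_def order_complex_below_top lower_def)
  qed
  ultimately show ?thesis
    by blast
qed

end
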